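(* Let $\mathfrak A$ be a Fraïssé class of finite structures (for a fixed relational signature) such that any two embeddings $Y\to X$, $Y\to Y'$ in $\mathfrak A$ have only finitely many amalgamations in $\mathfrak A$ up to isomorphism. If $\mathfrak A$ is smoothly approximable, then $\Theta^*(\mathfrak A)\otimes\mathbb Q$ is non-zero.
   Context: A signature is a collection $\{(R_i,n_i)\}_{i\in I}$ of relation symbols with arities $n_i\ge 1$; a structure is a set with an $n_i$-ary relation $R_i$ for each $i$. Subsets inherit induced substructures; an embedding $Y\to X$ is an injection inducing an isomorphism of $Y$ with the induced substructure on its image. An amalgamation of embeddings $i\colon Y\to X$, $j\colon Y\to Y'$ is a triple $(X',i',j')$ with $X'$ a structure and $i'\colon Y'\to X'$, $j'\colon X\to X'$ embeddings with $i'\circ j=j'\circ i$ and $X'=\mathrm{im}(i')\cup\mathrm{im}(j')$; these are considered up to the evident notion of isomorphism. A class $\mathfrak A$ of finite structures is a Fraïssé class if: it is closed under isomorphism; it is closed under substructures; it has only countably many members up to isomorphism; and any two embeddings $Y\to X$, $Y\to Y'$ in $\mathfrak A$ have an amalgamation in $\mathfrak A$. For $X,\Gamma\in\mathfrak A$ let $h_\Gamma(X)$ be the set of embeddings $X\to\Gamma$. $\Gamma\in\mathfrak A$ is homogeneous if $\mathrm{Aut}(\Gamma)$ acts transitively on $h_\Gamma(X)$ for every $X\in\mathfrak A$ with $h_\Gamma(X)\neq\emptyset$. $\mathfrak A$ is smoothly approximable if every object of $\mathfrak A$ embeds into a homogeneous object of $\mathfrak A$. $\Theta(\mathfrak A)$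 is the commutative ring generated by classes $[i]$ for embeddings $i\colon Y\to X$ in $\mathfrak A$, with relations: (a) $[i]=1$ if $i$ is an isomorphism; (b) $[i\circ j]=[i][j]$ for composable embeddings; (c) for embeddings $i\colon Y\to X$, $j\colon Y\to Y'$ in $\mathfrak A$, if $(X'_\alpha,i'_\alpha,j'_\alpha)$, $1\le\alpha\le r$, are the amalgamations of $(i,j)$ in $\mathfrak A$ (one from each isomorphism class), then $[i]=\sum_{\alpha=1}^r[i'_\alpha]$. $\Theta^*(\mathfrak A)$ is the localization of $\Theta(\mathfrak A)$ obtained by inverting $[i]$ for all embeddings $i$ in $\mathfrak A$. *)

theory Defs
  imports "HOL-Algebra.QuotRing" "HOL-Algebra.Generated_Groups" "HOL-Algebra.Free_Abelian_Groups"
    "HOL-Library.Poly_Mapping" "HOL-Library.Countable_Set"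
begin

section \<open>Relational structures and embeddings\<close>

text \<open>
  A signature is a partial map \<open>\<sigma>\<close> from symbols to arities; the index set is \<open>dom \<sigma>\<close> (possibly
  empty).  Structures live on subsets of an ambient type \<open>'a\<close>.  As soon as \<open>'a\<close> is infinite, every
  finite structure is isomorphic to one of these, so an isomorphism-closed class of finite structures
  is the same as an isomorphism-closed set of structures on finite subsets of \<open>'a\<close>.
\<close>

definition signature :: "('r \<rightharpoonup> nat) \<Rightarrow> bool"
  where "signature \<sigma> \<longleftrightarrow> (\<forall>n \<in> ran \<sigma>. n \<ge> 1)"

record ('a, 'r) rel_struct = "'a partial_object" +
  interp :: "'r \<Rightarrow> 'a list set"

text \<open>The condition forces \<open>interp X r = {}\<close> for \<open>r \<notin> dom \<sigma>\<close>, so that equality of records is equality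
  of structures.\<close>

definition structure_over :: "('r \<rightharpoonup> nat) \<Rightarrow> ('a, 'r) rel_struct \<Rightarrow> bool"
  where "structure_over \<sigma> X \<longleftrightarrow>
    (\<forall>r. \<forall>xs \<in> interp X r. \<sigma> r = Some (length xs) \<and> set xs \<subseteq> carrier X)"

definition induced :: "('a, 'r) rel_struct \<Rightarrow> 'a set \<Rightarrow> ('a, 'r) rel_struct"
  where "induced X S = \<lparr>carrier = S, interp = (\<lambda>r. {xs \<in> interp X r. set xs \<subseteq> S})\<rparr>"

text \<open>Maps of structures are extensional functions, so that equality of functions in HOL is equality
  of maps on the carrier.\<close>

definition isos :: "('a, 'r) rel_struct \<Rightarrow> ('a, 'r) rel_struct \<Rightarrow> ('a \<Rightarrow> 'a) set"
  where "isos X Y = {f \<in> carrier X \<rightarrow>\<^sub>E carrier Y. bij_betw f (carrier X) (carrier Y) \<and>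
    (\<forall>r xs. set xs \<subseteq> carrier X \<longrightarrow> (xs \<in> interp X r \<longleftrightarrow> map f xs \<in> interp Y r))}"

definition isomorphic :: "('a, 'r) rel_struct \<Rightarrow> ('a, 'r) rel_struct \<Rightarrow> bool"
  where "isomorphic X Y \<longleftrightarrow> isos X Y \<noteq> {}"

definition embeddings :: "('a, 'r) rel_struct \<Rightarrow> ('a, 'r) rel_struct \<Rightarrow> ('a \<Rightarrow> 'a) set"
  where "embeddings Y X = {f \<in> carrier Y \<rightarrow>\<^sub>E carrier X. inj_on f (carrier Y) \<and>
    f \<in> isos Y (induced X (f ` carrier Y))}"


section \<open>Amalgamations\<close>

type_synonym ('a, 'r) amalgam = "('a, 'r) rel_struct \<times> ('a \<Rightarrow> 'a) \<times> ('a \<Rightarrow> 'a)"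

text \<open>Amalgamations \<open>(X', i', j')\<close>, with \<open>X'\<close> in \<open>\<AA>\<close>, of \<open>i : Y \<rightarrow> X\<close> and \<open>j : Y \<rightarrow> Y'\<close>; here
  \<open>i' : Y' \<rightarrow> X'\<close> and \<open>j' : X \<rightarrow> X'\<close>.\<close>

definition amalgamations :: "('a, 'r) rel_struct set \<Rightarrow>
    ('a, 'r) rel_struct \<Rightarrow> ('a, 'r) rel_struct \<Rightarrow> ('a, 'r) rel_struct \<Rightarrow>
    ('a \<Rightarrow> 'a) \<Rightarrow> ('a \<Rightarrow> 'a) \<Rightarrow> ('a, 'r) amalgam set"
  where "amalgamations \<AA> Y X Y' i j = {(X', i', j'). X' \<in> \<AA> \<and>
    i' \<in> embeddings Y' X' \<and> j' \<in> embeddings X X' \<and>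
    compose (carrier Y) i' j = compose (carrier Y) j' i \<and>
    carrier X' = i' ` carrier Y' \<union> j' ` carrier X}"

definition amalgam_iso :: "('a, 'r) rel_struct \<Rightarrow> ('a, 'r) rel_struct \<Rightarrow>
    ('a, 'r) amalgam \<Rightarrow> ('a, 'r) amalgam \<Rightarrow> bool"
  where "amalgam_iso X Y' = (\<lambda>(X\<^sub>1, i\<^sub>1, j\<^sub>1) (X\<^sub>2, i\<^sub>2, j\<^sub>2).
    \<exists>h \<in> isos X\<^sub>1 X\<^sub>2. compose (carrier Y') h i\<^sub>1 = i\<^sub>2 \<and> compose (carrier X) h j\<^sub>1 = j\<^sub>2)"

definition amalgamation_classes :: "('a, 'r) rel_struct set \<Rightarrow>
    ('a, 'r) rel_struct \<Rightarrow> ('a, 'r) rel_struct \<Rightarrow> ('a, 'r) rel_struct \<Rightarrow>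
    ('a \<Rightarrow> 'a) \<Rightarrow> ('a \<Rightarrow> 'a) \<Rightarrow> ('a, 'r) amalgam set set"
  where "amalgamation_classes \<AA> Y X Y' i j = amalgamations \<AA> Y X Y' i j //
    {(a, b). a \<in> amalgamations \<AA> Y X Y' i j \<and> b \<in> amalgamations \<AA> Y X Y' i j \<and>
      amalgam_iso X Y' a b}"

definition finitely_many_amalgamations :: "('a, 'r) rel_struct set \<Rightarrow> bool"
  where "finitely_many_amalgamations \<AA> \<longleftrightarrow> (\<forall>Y \<in> \<AA>. \<forall>X \<in> \<AA>. \<forall>Y' \<in> \<AA>.
    \<forall>i \<in> embeddings Y X. \<forall>j \<in> embeddings Y Y'. finite (amalgamation_classes \<AA> Y X Y' i j))"

text \<open>\<open>T\<close> contains exactly one amalgamation from each isomorphism class.\<close>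

definition amalgamation_reps :: "('a, 'r) rel_struct set \<Rightarrow>
    ('a, 'r) rel_struct \<Rightarrow> ('a, 'r) rel_struct \<Rightarrow> ('a, 'r) rel_struct \<Rightarrow>
    ('a \<Rightarrow> 'a) \<Rightarrow> ('a \<Rightarrow> 'a) \<Rightarrow> ('a, 'r) amalgam set \<Rightarrow> bool"
  where "amalgamation_reps \<AA> Y X Y' i j T \<longleftrightarrow> T \<subseteq> amalgamations \<AA> Y X Y' i j \<and>
    (\<forall>a \<in> amalgamations \<AA> Y X Y' i j. \<exists>!t. t \<in> T \<and> amalgam_iso X Y' a t)"


section \<open>Fraisse classes and smoothly approximable classes\<close>

definition fraisse_class :: "('r \<rightharpoonup> nat) \<Rightarrow> ('a, 'r) rel_struct set \<Rightarrow> bool"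
  where "fraisse_class \<sigma> \<AA> \<longleftrightarrow>
    (\<forall>X \<in> \<AA>. structure_over \<sigma> X \<and> finite (carrier X)) \<and>
    (\<forall>X \<in> \<AA>. \<forall>Y. structure_over \<sigma> Y \<and> isomorphic X Y \<longrightarrow> Y \<in> \<AA>) \<and>
    (\<forall>X \<in> \<AA>. \<forall>S. S \<subseteq> carrier X \<longrightarrow> induced X S \<in> \<AA>) \<and>
    countable (\<AA> // {(X, Y). X \<in> \<AA> \<and> Y \<in> \<AA> \<and> isomorphic X Y}) \<and>
    (\<forall>Y \<in> \<AA>. \<forall>X \<in> \<AA>. \<forall>Y' \<in> \<AA>. \<forall>i \<in> embeddings Y X. \<forall>j \<in> embeddings Y Y'.
      amalgamations \<AA> Y X Y' i j \<noteq> {})"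

definition homogeneous :: "('a, 'r) rel_struct set \<Rightarrow> ('a, 'r) rel_struct \<Rightarrow> bool"
  where "homogeneous \<AA> \<Gamma> \<longleftrightarrow> (\<forall>X \<in> \<AA>. \<forall>f \<in> embeddings X \<Gamma>. \<forall>g \<in> embeddings X \<Gamma>.
    \<exists>\<tau> \<in> isos \<Gamma> \<Gamma>. compose (carrier X) \<tau> f = g)"

definition smoothly_approximable :: "('a, 'r) rel_struct set \<Rightarrow> bool"
  where "smoothly_approximable \<AA> \<longleftrightarrow>
    (\<forall>X \<in> \<AA>. \<exists>\<Gamma> \<in> \<AA>. homogeneous \<AA> \<Gamma> \<and> embeddings X \<Gamma> \<noteq> {})"


section \<open>Polynomial rings, localization, tensor products\<close>

text \<open>\<open>\<int>[x\<^sub>g | g \<in> G]\<close>: a monomial is a finitely supported exponent function \<open>'g \<Rightarrow>\<^sub>0 nat\<close>.\<close>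

definition int_poly_ring :: "'g set \<Rightarrow> (('g \<Rightarrow>\<^sub>0 nat) \<Rightarrow>\<^sub>0 int) ring"
  where "int_poly_ring G = \<lparr>
    carrier = {p. \<forall>m \<in> Poly_Mapping.keys p. Poly_Mapping.keys m \<subseteq> G},
    mult = (*), one = 1, ring.zero = 0, ring.add = (+)\<rparr>"

definition poly_var :: "'g \<Rightarrow> (('g \<Rightarrow>\<^sub>0 nat) \<Rightarrow>\<^sub>0 int)"
  where "poly_var g = Poly_Mapping.single (Poly_Mapping.single g 1) 1"

definition submonoid_generated :: "('b, 'm) monoid_scheme \<Rightarrow> 'b set \<Rightarrow> 'b set"
  where "submonoid_generated R S = \<Inter> {M. submonoid M R \<and> S \<subseteq> M}"

definition frac_rel :: "('b, 'm) ring_scheme \<Rightarrow> 'b set \<Rightarrow> (('b \<times> 'b) \<times> ('b \<times> 'b)) set"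
  where "frac_rel R M = {((r, s), (r', s')).
    r \<in> carrier R \<and> s \<in> M \<and> r' \<in> carrier R \<and> s' \<in> M \<and>
    (\<exists>u \<in> M. u \<otimes>\<^bsub>R\<^esub> (r \<otimes>\<^bsub>R\<^esub> s') = u \<otimes>\<^bsub>R\<^esub> (r' \<otimes>\<^bsub>R\<^esub> s))}"

text \<open>The ring of fractions \<open>M\<^sup>-\<^sup>1 R\<close> of a commutative ring at a multiplicative submonoid \<open>M\<close>.  The
  unions below are over all representatives and hence consist of a single class.\<close>

definition ring_of_fractions :: "('b, 'm) ring_scheme \<Rightarrow> 'b set \<Rightarrow> ('b \<times> 'b) set ring"
  where "ring_of_fractions R M = \<lparr>
    carrier = (carrier R \<times> M) // frac_rel R M,
    mult = (\<lambda>A B. \<Union>(r, s) \<in> A. \<Union>(r', s') \<in> B.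
      frac_rel R M `` {(r \<otimes>\<^bsub>R\<^esub> r', s \<otimes>\<^bsub>R\<^esub> s')}),
    one = frac_rel R M `` {(\<one>\<^bsub>R\<^esub>, \<one>\<^bsub>R\<^esub>)},
    ring.zero = frac_rel R M `` {(\<zero>\<^bsub>R\<^esub>, \<one>\<^bsub>R\<^esub>)},
    ring.add = (\<lambda>A B. \<Union>(r, s) \<in> A. \<Union>(r', s') \<in> B.
      frac_rel R M `` {(r \<otimes>\<^bsub>R\<^esub> s' \<oplus>\<^bsub>R\<^esub> r' \<otimes>\<^bsub>R\<^esub> s, s \<otimes>\<^bsub>R\<^esub> s')})\<rparr>"

definition localization :: "('b, 'm) ring_scheme \<Rightarrow> 'b set \<Rightarrow> ('b \<times> 'b) set ring"
  where "localization R S = ring_of_fractions R (submonoid_generated R S)"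

text \<open>The tensor product over \<open>\<int>\<close> of two abelian groups (written multiplicatively, as always in
  HOL-Algebra; the result has neutral element \<open>\<one>\<close>): the free abelian group on pairs modulo
  bilinearity.\<close>

definition bilinear_relations ::
    "('b, 'm) monoid_scheme \<Rightarrow> ('c, 'n) monoid_scheme \<Rightarrow> ('b \<times> 'c \<Rightarrow>\<^sub>0 int) set"
  where "bilinear_relations G H =
    {frag_of (x \<otimes>\<^bsub>G\<^esub> x', y) - frag_of (x, y) - frag_of (x', y) | x x' y.
      x \<in> carrier G \<and> x' \<in> carrier G \<and> y \<in> carrier H} \<union>
    {frag_of (x, y \<otimes>\<^bsub>H\<^esub> y') - frag_of (x, y) - frag_of (x, y') | x y y'.
      x \<in> carrier G \<and> y \<in> carrier H \<and> y' \<in> carrier H}"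

definition tensor_product ::
    "('b, 'm) monoid_scheme \<Rightarrow> ('c, 'n) monoid_scheme \<Rightarrow> ('b \<times> 'c \<Rightarrow>\<^sub>0 int) set monoid"
  where "tensor_product G H =
    (let F = free_Abelian_group (carrier G \<times> carrier H)
     in F Mod generate F (bilinear_relations G H))"

definition rational_group :: "rat monoid"
  where "rational_group = \<lparr>carrier = UNIV, mult = (+), one = 0\<rparr>"


section \<open>The rings \<open>\<Theta>(\<AA>)\<close> and \<open>\<Theta>\<^sup>*(\<AA>)\<close>\<close>

type_synonym ('a, 'r) arrow = "('a, 'r) rel_struct \<times> ('a \<Rightarrow> 'a) \<times> ('a, 'r) rel_struct"

text \<open>The triple \<open>(Y, i, X)\<close> stands for the embedding \<open>i : Y \<rightarrow> X\<close>.\<close>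

definition arrows :: "('a, 'r) rel_struct set \<Rightarrow> ('a, 'r) arrow set"
  where "arrows \<AA> = {(Y, i, X). Y \<in> \<AA> \<and> X \<in> \<AA> \<and> i \<in> embeddings Y X}"

definition theta_relations ::
    "('a, 'r) rel_struct set \<Rightarrow> ((('a, 'r) arrow \<Rightarrow>\<^sub>0 nat) \<Rightarrow>\<^sub>0 int) set"
  where "theta_relations \<AA> =
    {poly_var (Y, i, X) - 1 | Y i X. Y \<in> \<AA> \<and> X \<in> \<AA> \<and> i \<in> isos Y X} \<union>
    {poly_var (Z, compose (carrier Z) i j, X) - poly_var (Y, i, X) * poly_var (Z, j, Y)
      | Z j Y i X. (Z, j, Y) \<in> arrows \<AA> \<and> (Y, i, X) \<in> arrows \<AA>} \<union>
    {poly_var (Y, i, X) - (\<Sum>(X', i', j') \<in> T. poly_var (Y', i', X'))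
      | Y i X j Y' T. (Y, i, X) \<in> arrows \<AA> \<and> (Y, j, Y') \<in> arrows \<AA> \<and>
        finite T \<and> amalgamation_reps \<AA> Y X Y' i j T}"

definition theta_ideal ::
    "('a, 'r) rel_struct set \<Rightarrow> ((('a, 'r) arrow \<Rightarrow>\<^sub>0 nat) \<Rightarrow>\<^sub>0 int) set"
  where "theta_ideal \<AA> = genideal (int_poly_ring (arrows \<AA>)) (theta_relations \<AA>)"

definition Theta ::
    "('a, 'r) rel_struct set \<Rightarrow> ((('a, 'r) arrow \<Rightarrow>\<^sub>0 nat) \<Rightarrow>\<^sub>0 int) set ring"
  where "Theta \<AA> = int_poly_ring (arrows \<AA>) Quot theta_ideal \<AA>"

definition theta_class :: "('a, 'r) rel_struct set \<Rightarrow> ('a, 'r) arrow \<Rightarrow>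
    ((('a, 'r) arrow \<Rightarrow>\<^sub>0 nat) \<Rightarrow>\<^sub>0 int) set"
  where "theta_class \<AA> e = theta_ideal \<AA> +>\<^bsub>int_poly_ring (arrows \<AA>)\<^esub> poly_var e"

definition Theta_star where
  "Theta_star \<AA> = localization (Theta \<AA>) (theta_class \<AA> ` arrows \<AA>)"

text \<open>The abelian group underlying the ring \<open>\<Theta>\<^sup>*(\<AA>) \<otimes>\<^sub>\<int> \<rat>\<close>; the ring is non-zero iff this group
  has an element other than the neutral one.\<close>

definition Theta_star_rat where
  "Theta_star_rat \<AA> = tensor_product (add_monoid (Theta_star \<AA>)) rational_group"

end

theory Submission
  imports Defs
begin

text \<open>
  Let \<open>\<Gamma>\<close> be homogeneous and let \<open>i : Y \<rightarrow> X\<close> be an embedding, where \<open>Y\<close> embeds into \<open>\<Gamma>\<close>.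
  Since \<open>Aut(\<Gamma>)\<close> permutes the embeddings \<open>f : Y \<rightarrow> \<Gamma>\<close> transitively, every such \<open>f\<close> has the same
  number of extensions along \<open>i\<close> to an embedding \<open>X \<rightarrow> \<Gamma>\<close>, namely the ratio
  \<open>\<bar>h\<^sub>\<Gamma>(X)\<bar> / \<bar>h\<^sub>\<Gamma>(Y)\<bar>\<close> (lemma \<open>card_extensions\<close>).  Sending \<open>[i]\<close> to this ratio respects the defining
  relations of \<open>\<Theta>(\<AA>)\<close>, as long as the objects involved embed into \<open>\<Gamma>\<close>: isomorphisms have ratio 1,
  ratios telescope along compositions, and for the amalgamation relation one fixes
  \<open>f : Y' \<rightarrow> \<Gamma>\<close> and observes that an extension of \<open>f \<circ> j\<close> to \<open>X\<close> generates, together with \<open>f\<close>, an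
  amalgamation inside \<open>\<Gamma>\<close>, so that extensions of \<open>f \<circ> j\<close> along \<open>i\<close> are partitioned into
  the extensions of \<open>f\<close> along the various \<open>i'\<^sub>\<alpha>\<close> (lemma \<open>extensions_split_amalgamations\<close>).

  No single finite \<open>\<Gamma>\<close> contains all objects of \<open>\<AA>\<close> in general, so one passes to the limit.
  By smooth approximation and joint embedding, the homogeneous \<open>\<Gamma>\<close> containing a prescribed object
  generate a proper filter (lemma \<open>homogeneous_germs_not_bot\<close>).  Along it, the ratios define a ring
  homomorphism from \<open>\<Theta>(\<AA>)\<close> to the ring of germs of rational-valued functions of \<open>\<Gamma>\<close>.  This target is
  a non-zero \<open>\<rat>\<close>-algebra in which every \<open>[i]\<close> becomes invertible, because its value is eventually
  non-zero.  Hence the homomorphism extends to \<open>\<Theta>\<^sup>*(\<AA>) \<otimes> \<rat>\<close> and sends \<open>1 \<otimes> 1\<close> to the germ \<open>1 \<noteq> 0\<close>.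

  The ring of germs is never formed: a map into it is represented by a family \<open>\<phi> i\<close> of functions,
  and equations between germs are equations that hold eventually in \<open>i\<close>.
\<close>


section \<open>Embeddings of relational structures\<close>

lemma embeddings_iff:
  "f \<in> embeddings Y X \<longleftrightarrow> f \<in> carrier Y \<rightarrow>\<^sub>E carrier X \<and> inj_on f (carrier Y) \<and>
    (\<forall>r xs. set xs \<subseteq> carrier Y \<longrightarrow> (xs \<in> interp Y r \<longleftrightarrow> map f xs \<in> interp X r))"
proof -
  have "set (map f xs) \<subseteq> f ` carrier Y" if "set xs \<subseteq> carrier Y" for xs
    using that by auto
  then show ?thesis
    unfolding embeddings_def isos_def induced_def by (auto simp: bij_betw_def PiE_iff)
qed

lemma isos_iff_embeddings: "f \<in> isos Y X \<longleftrightarrow> f \<in> embeddings Y X \<and> f ` carrier Y = carrier X"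
  unfolding embeddings_iff isos_def bij_betw_def by auto

lemma embeddings_compose:
  assumes "i \<in> embeddings Y X" "g \<in> embeddings X Z"
  shows "compose (carrier Y) g i \<in> embeddings Y Z"
proof -
  have map_eq: "map (compose (carrier Y) g i) xs = map g (map i xs)" "set (map i xs) \<subseteq> carrier X"
    if "set xs \<subseteq> carrier Y" for xs
    using that assms(1) unfolding embeddings_iff by (auto simp: compose_eq)
  have "inj_on (compose (carrier Y) g i) (carrier Y)"
    using assms unfolding embeddings_iff inj_on_def by (auto simp: compose_eq PiE_iff)
  moreover have "compose (carrier Y) g i \<in> carrier Y \<rightarrow>\<^sub>E carrier Z"
    using assms unfolding embeddings_iff by (auto simp: compose_def)
  ultimately show ?thesis
    using assms map_eq unfolding embeddings_iff by metis
qed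

lemma PiE_eq_on_image:
  assumes g: "g \<in> carrier X \<rightarrow>\<^sub>E A" "g' \<in> carrier X \<rightarrow>\<^sub>E A'"
    and "\<And>y. y \<in> S \<Longrightarrow> g (i y) = g' (i y)" "carrier X \<subseteq> i ` S"
  shows "g = g'"
proof
  fix x show "g x = g' x"
    using assms PiE_arb[OF g(1), of x] PiE_arb[OF g(2), of x] by (cases "x \<in> carrier X") auto
qed

lemma finite_embeddings: "finite (carrier Y) \<Longrightarrow> finite (carrier X) \<Longrightarrow> finite (embeddings Y X)"
  by (rule finite_subset[of _ "carrier Y \<rightarrow>\<^sub>E carrier X"]) (auto simp: embeddings_iff intro: finite_PiE)

lemma isos_inverse:
  assumes h: "h \<in> isos X Y"
  obtains k where "k \<in> isos Y X" "\<And>x. x \<in> carrier X \<Longrightarrow> k (h x) = x" "\<And>y. y \<in> carrier Y \<Longrightarrow> h (k y) = y"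
proof -
  define k where "k = restrict (inv_into (carrier X) h) (carrier Y)"
  have bij: "bij_betw h (carrier X) (carrier Y)"
    using h unfolding isos_def by blast
  have kh: "k (h x) = x" if "x \<in> carrier X" for x
    using that bij unfolding k_def bij_betw_def by auto
  have hk: "h (k y) = y" if "y \<in> carrier Y" for y
    using that bij unfolding k_def bij_betw_def by (auto simp: f_inv_into_f)
  have bij': "bij_betw k (carrier Y) (carrier X)"
    using bij_betw_inv_into[OF bij] unfolding k_def by (simp add: bij_betw_restrict_eq)
  have "ys \<in> interp Y r \<longleftrightarrow> map k ys \<in> interp X r" if "set ys \<subseteq> carrier Y" for ys r
  proof -
    have "set (map k ys) \<subseteq> carrier X"
      using that bij' by (auto dest: bij_betwE)
    moreover have "map h (map k ys) = ys"
      using that hk by (auto intro!: map_idI)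
    ultimately show ?thesis
      using h unfolding isos_def by auto
  qed
  then have "k \<in> isos Y X"
    using bij' unfolding isos_def by (auto simp: bij_betwE k_def)
  with kh hk show ?thesis
    using that by blast
qed

text \<open>
  Restriction along a surjective map is injective, which gives one inequality for \<open>i\<close> and the other
  one for its inverse.
\<close>
lemma card_embeddings_isos:
  fixes X Y Z :: "('a, 'r) rel_struct"
  assumes "finite (carrier X)" "finite (carrier Y)" "finite (carrier Z)" "i \<in> isos Y X"
  shows "card (embeddings X Z) = card (embeddings Y Z)"
proof -
  have le: "card (embeddings B Z) \<le> card (embeddings A Z)"
    if "j \<in> isos A B" "finite (carrier A)" for j and A B :: "('a, 'r) rel_struct"
  proof (rule card_inj_on_le)
    have j: "j \<in> embeddings A B" "j ` carrier A = carrier B"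
      using that(1) unfolding isos_iff_embeddings by auto
    show "inj_on (\<lambda>g. compose (carrier A) g j) (embeddings B Z)"
    proof (rule inj_onI)
      fix g g' assume g: "g \<in> embeddings B Z" "g' \<in> embeddings B Z"
        and eq: "compose (carrier A) g j = compose (carrier A) g' j"
      have "g (j y) = g' (j y)" if "y \<in> carrier A" for y
        using fun_cong[OF eq, of y] that by (simp add: compose_eq)
      then show "g = g'"
        using g j(2) unfolding embeddings_iff
        by (intro PiE_eq_on_image[of g B "carrier Z" g' "carrier Z" "carrier A" j]) auto
    qed
    show "(\<lambda>g. compose (carrier A) g j) ` embeddings B Z \<subseteq> embeddings A Z"
      using embeddings_compose[OF j(1)] by blast
    show "finite (embeddings A Z)"
      using that(2) assms(3) by (rule finite_embeddings)
  qed
  obtain k where "k \<in> isos X Y"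
    using isos_inverse[OF assms(4)] by blast
  then show ?thesis
    using le[OF assms(4)] le[of k] assms by (simp add: le_antisym)
qed

lemma induced_inclusion:
  assumes "S \<subseteq> carrier X"
  shows "(\<lambda>x \<in> S. x) \<in> embeddings (induced X S) X"
proof -
  have "map (\<lambda>x \<in> S. x) xs = xs" if "set xs \<subseteq> S" for xs
    using that by (auto intro!: map_idI)
  then show ?thesis
    using assms unfolding embeddings_iff induced_def by (auto simp: inj_on_def)
qed

lemma embeddings_corestrict:
  assumes "f \<in> embeddings Y X" "f ` carrier Y \<subseteq> S"
  shows "f \<in> embeddings Y (induced X S)"
proof -
  have "set (map f xs) \<subseteq> S" if "set xs \<subseteq> carrier Y" for xs
    using that assms(2) by auto
  then show ?thesis
    using assms unfolding embeddings_iff induced_def by (auto simp: PiE_iff)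
qed


section \<open>Counting extensions into a homogeneous structure\<close>

definition extensions ::
    "('a, 'r) rel_struct \<Rightarrow> ('a, 'r) rel_struct \<Rightarrow> ('a \<Rightarrow> 'a) \<Rightarrow> ('a, 'r) rel_struct \<Rightarrow> ('a \<Rightarrow> 'a) \<Rightarrow> ('a \<Rightarrow> 'a) set"
  where "extensions \<Gamma> Y i X f = {g \<in> embeddings X \<Gamma>. compose (carrier Y) g i = f}"

text \<open>
  Restriction along \<open>i\<close> maps the embeddings of \<open>X\<close> to those of \<open>Y\<close>, with fibres the sets of extensions.
  An automorphism of \<open>\<Gamma>\<close> carrying \<open>f'\<close> to \<open>f''\<close> carries the fibre over \<open>f'\<close> injectively into the fibre
  over \<open>f''\<close>; by homogeneity such automorphisms exist in both directions, so all fibres have equal size.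
\<close>
lemma card_extensions:
  assumes hom: "homogeneous \<AA> \<Gamma>" and fin: "finite (carrier \<Gamma>)" "finite (carrier X)" "finite (carrier Y)"
    and Y: "Y \<in> \<AA>" and i: "i \<in> embeddings Y X" and f: "f \<in> embeddings Y \<Gamma>"
  shows "card (extensions \<Gamma> Y i X f) * card (embeddings Y \<Gamma>) = card (embeddings X \<Gamma>)"
proof -
  have finX: "finite (embeddings X \<Gamma>)" and finY: "finite (embeddings Y \<Gamma>)"
    using fin by (simp_all add: finite_embeddings)
  have fin_ext: "finite (extensions \<Gamma> Y i X f')" for f'
    using finX by (simp add: extensions_def)
  have le: "card (extensions \<Gamma> Y i X f') \<le> card (extensions \<Gamma> Y i X f'')"
    if f': "f' \<in> embeddings Y \<Gamma>" "f'' \<in> embeddings Y \<Gamma>" for f' f''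
  proof -
    obtain \<tau> where \<tau>: "\<tau> \<in> isos \<Gamma> \<Gamma>" "compose (carrier Y) \<tau> f' = f''"
      using hom Y f' unfolding homogeneous_def by blast
    have \<tau>e: "\<tau> \<in> embeddings \<Gamma> \<Gamma>"
      using \<tau>(1) by (simp add: isos_iff_embeddings)
    show ?thesis
    proof (rule card_inj_on_le[OF _ _ fin_ext])
      show "inj_on (compose (carrier X) \<tau>) (extensions \<Gamma> Y i X f')"
      proof (rule inj_onI)
        fix g g' assume g: "g \<in> extensions \<Gamma> Y i X f'" "g' \<in> extensions \<Gamma> Y i X f'"
          and eq: "compose (carrier X) \<tau> g = compose (carrier X) \<tau> g'"
        have gE: "g \<in> carrier X \<rightarrow>\<^sub>E carrier \<Gamma>" "g' \<in> carrier X \<rightarrow>\<^sub>E carrier \<Gamma>"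
          using g by (auto simp: extensions_def embeddings_iff)
        have "g x = g' x" if x: "x \<in> carrier X" for x
        proof (rule inj_onD)
          show "inj_on \<tau> (carrier \<Gamma>)"
            using \<tau>e by (simp add: embeddings_iff)
          show "\<tau> (g x) = \<tau> (g' x)"
            using fun_cong[OF eq, of x] x by (simp add: compose_eq)
        qed (use gE x in auto)
        then show "g = g'"
          using gE by (blast intro: PiE_ext)
      qed
      show "compose (carrier X) \<tau> ` extensions \<Gamma> Y i X f' \<subseteq> extensions \<Gamma> Y i X f''"
      proof clarify
        fix g assume g: "g \<in> extensions \<Gamma> Y i X f'"
        then have "compose (carrier X) \<tau> g \<in> embeddings X \<Gamma>"
          using \<tau>e by (auto simp: extensions_def intro: embeddings_compose)
        moreover have "i \<in> carrier Y \<rightarrow> carrier X"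
          using i by (auto simp: embeddings_iff)
        then have "compose (carrier Y) (compose (carrier X) \<tau> g) i = f''"
          using g \<tau>(2) unfolding extensions_def by (auto simp: compose_assoc)
        ultimately show "compose (carrier X) \<tau> g \<in> extensions \<Gamma> Y i X f''"
          by (simp add: extensions_def)
      qed
    qed
  qed
  have "embeddings X \<Gamma> = (\<Union>f' \<in> embeddings Y \<Gamma>. extensions \<Gamma> Y i X f')"
    using embeddings_compose[OF i] by (auto simp: extensions_def)
  moreover have "card (\<Union>f' \<in> embeddings Y \<Gamma>. extensions \<Gamma> Y i X f') =
      (\<Sum>f' \<in> embeddings Y \<Gamma>. card (extensions \<Gamma> Y i X f'))"
    using finY fin_ext by (intro card_UN_disjoint) (auto simp: extensions_def)
  moreover have "card (extensions \<Gamma> Y i X f') = card (extensions \<Gamma> Y i X f)" if "f' \<in> embeddings Y \<Gamma>" for f'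
    using le[OF that f] le[OF f that] by simp
  ultimately show ?thesis
    by simp
qed

text \<open>
  This is the geometric content of the amalgamation relation.  An extension \<open>g\<close> of \<open>f \<circ> j\<close> to \<open>X\<close>
  makes the substructure of \<open>\<Gamma>\<close> on \<open>im f \<union> im g\<close> an amalgamation.  It is isomorphic to exactly one
  representative \<open>X'\<close> in \<open>T\<close>, and the isomorphism is an embedding \<open>k : X' \<rightarrow> \<Gamma>\<close> extending \<open>f\<close>
  along \<open>i'\<close> and restricting to \<open>g\<close>.  It is the only one, as \<open>X'\<close> is covered by \<open>Y'\<close> and \<open>X\<close>.
\<close>
lemma extensions_split_amalgamations:
  assumes sub: "\<And>S. S \<subseteq> carrier \<Gamma> \<Longrightarrow> induced \<Gamma> S \<in> \<AA>"
    and i: "i \<in> embeddings Y X" and j: "j \<in> embeddings Y Y'"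
    and T: "amalgamation_reps \<AA> Y X Y' i j T"
    and f: "f \<in> embeddings Y' \<Gamma>"
  shows "bij_betw (\<lambda>((X', i', j'), k). compose (carrier X) k j')
    (SIGMA (X', i', j') : T. extensions \<Gamma> Y' i' X' f)
    (extensions \<Gamma> Y i X (compose (carrier Y) f j))"
    (is "bij_betw ?F ?D ?E")
  unfolding bij_betw_def
proof
  have T_sub: "T \<subseteq> amalgamations \<AA> Y X Y' i j"
    and T_unique: "\<And>a t t'. a \<in> amalgamations \<AA> Y X Y' i j \<Longrightarrow> t \<in> T \<Longrightarrow> t' \<in> T \<Longrightarrow>
      amalgam_iso X Y' a t \<Longrightarrow> amalgam_iso X Y' a t' \<Longrightarrow> t = t'"
    and T_ex: "\<And>a. a \<in> amalgamations \<AA> Y X Y' i j \<Longrightarrow> \<exists>t \<in> T. amalgam_iso X Y' a t"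
    using T unfolding amalgamation_reps_def by blast+
  have ij: "i \<in> carrier Y \<rightarrow> carrier X" "j \<in> carrier Y \<rightarrow> carrier Y'"
    using i j by (auto simp: embeddings_iff)
  have amalgam: "X' \<in> \<AA>" "i' \<in> embeddings Y' X'" "j' \<in> embeddings X X'"
      "compose (carrier Y) i' j = compose (carrier Y) j' i"
      "carrier X' = i' ` carrier Y' \<union> j' ` carrier X"
    if "(X', i', j') \<in> T" for X' i' j'
    using that T_sub unfolding amalgamations_def by auto
  \<comment> \<open>The amalgamation spanned inside \<open>\<Gamma>\<close> by \<open>f\<close> and an extension \<open>g\<close>.\<close>
  define W where "W g = induced \<Gamma> (f ` carrier Y' \<union> g ` carrier X)" for g
  have W: "(W g, f, g) \<in> amalgamations \<AA> Y X Y' i j" if g: "g \<in> ?E" for g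
  proof -
    have ge: "g \<in> embeddings X \<Gamma>" "compose (carrier Y) g i = compose (carrier Y) f j"
      using g by (auto simp: extensions_def)
    moreover have "f ` carrier Y' \<union> g ` carrier X \<subseteq> carrier \<Gamma>"
      using f ge(1) by (auto simp: embeddings_iff)
    ultimately show ?thesis
      using f sub unfolding amalgamations_def W_def
      by (auto intro!: embeddings_corestrict) (auto simp: induced_def)
  qed
  have F_in: "compose (carrier X) k j' \<in> ?E"
    if t: "(X', i', j') \<in> T" and k: "k \<in> extensions \<Gamma> Y' i' X' f" for X' i' j' k
  proof -
    note a = amalgam[OF t]
    have k': "k \<in> embeddings X' \<Gamma>" "compose (carrier Y') k i' = f"
      using k by (auto simp: extensions_def)
    have "compose (carrier Y) (compose (carrier X) k j') i = compose (carrier Y) k (compose (carrier Y) j' i)"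
      by (rule compose_assoc[OF ij(1), symmetric])
    also have "\<dots> = compose (carrier Y) (compose (carrier Y') k i') j"
      unfolding a(4)[symmetric] by (rule compose_assoc[OF ij(2)])
    finally show ?thesis
      using embeddings_compose[OF a(3) k'(1)] k'(2) by (simp add: extensions_def)
  qed
  have iso: "amalgam_iso X Y' (W g, f, g) (X', i', j')"
    if t: "(X', i', j') \<in> T" and k: "k \<in> extensions \<Gamma> Y' i' X' f" and g: "g = compose (carrier X) k j'"
    for X' i' j' k g
  proof -
    note a = amalgam[OF t]
    have k': "k \<in> embeddings X' \<Gamma>" "compose (carrier Y') k i' = f"
      using k by (auto simp: extensions_def)
    have f_eq: "f y = k (i' y)" if "y \<in> carrier Y'" for y
      using fun_cong[OF k'(2), of y] that by (simp add: compose_eq)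
    have g_eq: "g x = k (j' x)" if "x \<in> carrier X" for x
      using that by (simp add: g compose_eq)
    have "k ` carrier X' = f ` carrier Y' \<union> g ` carrier X"
      unfolding a(5) image_Un image_image using f_eq g_eq by auto
    then have "k \<in> embeddings X' (W g)" "k ` carrier X' = carrier (W g)"
      unfolding W_def using embeddings_corestrict[OF k'(1)] by (simp_all add: induced_def)
    then have "k \<in> isos X' (W g)"
      by (simp add: isos_iff_embeddings)
    then obtain h where h: "h \<in> isos (W g) X'" "\<And>x. x \<in> carrier X' \<Longrightarrow> h (k x) = x"
      using isos_inverse by blast
    have "compose (carrier Y') h f = i'"
    proof
      fix y show "compose (carrier Y') h f y = i' y"
        using a(2,5) h(2) f_eq
        by (cases "y \<in> carrier Y'") (auto simp: compose_def embeddings_iff)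
    qed
    moreover have "compose (carrier X) h g = j'"
    proof
      fix x show "compose (carrier X) h g x = j' x"
        using a(3,5) h(2) g_eq
        by (cases "x \<in> carrier X") (auto simp: compose_def embeddings_iff)
    qed
    ultimately show ?thesis
      using h(1) by (auto simp: amalgam_iso_def)
  qed
  show "inj_on ?F ?D"
  proof (rule inj_onI)
    fix p q assume pq: "p \<in> ?D" "q \<in> ?D" "?F p = ?F q"
    obtain X\<^sub>1 i\<^sub>1 j\<^sub>1 k\<^sub>1 where p: "p = ((X\<^sub>1, i\<^sub>1, j\<^sub>1), k\<^sub>1)"
      by (metis prod_cases3 surj_pair)
    obtain X\<^sub>2 i\<^sub>2 j\<^sub>2 k\<^sub>2 where q: "q = ((X\<^sub>2, i\<^sub>2, j\<^sub>2), k\<^sub>2)"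
      by (metis prod_cases3 surj_pair)
    have t1: "(X\<^sub>1, i\<^sub>1, j\<^sub>1) \<in> T" and k1: "k\<^sub>1 \<in> extensions \<Gamma> Y' i\<^sub>1 X\<^sub>1 f"
      and t2: "(X\<^sub>2, i\<^sub>2, j\<^sub>2) \<in> T" and k2: "k\<^sub>2 \<in> extensions \<Gamma> Y' i\<^sub>2 X\<^sub>2 f"
      and eq: "compose (carrier X) k\<^sub>1 j\<^sub>1 = compose (carrier X) k\<^sub>2 j\<^sub>2"
      using pq unfolding p q by simp_all
    define g where "g = compose (carrier X) k\<^sub>1 j\<^sub>1"
    have "(X\<^sub>1, i\<^sub>1, j\<^sub>1) = (X\<^sub>2, i\<^sub>2, j\<^sub>2)"
      using T_unique[OF W t1 t2 iso[OF t1 k1] iso[OF t2 k2], of g] F_in[OF t1 k1] eq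
      by (simp add: g_def)
    then have t_eq: "X\<^sub>2 = X\<^sub>1" "i\<^sub>2 = i\<^sub>1" "j\<^sub>2 = j\<^sub>1"
      by auto
    note a = amalgam[OF t1]
    have kE: "k\<^sub>1 \<in> carrier X\<^sub>1 \<rightarrow>\<^sub>E carrier \<Gamma>" "k\<^sub>2 \<in> carrier X\<^sub>1 \<rightarrow>\<^sub>E carrier \<Gamma>"
      "compose (carrier Y') k\<^sub>1 i\<^sub>1 = compose (carrier Y') k\<^sub>2 i\<^sub>1"
      using k1 k2 by (auto simp: extensions_def embeddings_iff t_eq)
    have "k\<^sub>1 x = k\<^sub>2 x" if "x \<in> carrier X\<^sub>1" for x
      using that unfolding a(5)
    proof
      assume "x \<in> i\<^sub>1 ` carrier Y'"
      then obtain y where "y \<in> carrier Y'" "x = i\<^sub>1 y" by blast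
      then show ?thesis
        using fun_cong[OF kE(3), of y] by (simp add: compose_eq)
    next
      assume "x \<in> j\<^sub>1 ` carrier X"
      then obtain y where "y \<in> carrier X" "x = j\<^sub>1 y" by blast
      then show ?thesis
        using fun_cong[OF eq, of y] by (simp add: compose_eq t_eq)
    qed
    then have "k\<^sub>1 = k\<^sub>2"
      using kE by (blast intro: PiE_ext)
    then show "p = q"
      by (simp add: p q t_eq)
  qed
  show "?F ` ?D = ?E"
  proof
    show "?F ` ?D \<subseteq> ?E"
      using F_in by auto
    show "?E \<subseteq> ?F ` ?D"
    proof
      fix g assume g: "g \<in> ?E"
      then have ge: "g \<in> embeddings X \<Gamma>"
        by (simp add: extensions_def)
      obtain X' i' j' where t: "(X', i', j') \<in> T" "amalgam_iso X Y' (W g, f, g) (X', i', j')"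
        using T_ex[OF W[OF g]] by (metis prod_cases3)
      then obtain h where h: "h \<in> isos (W g) X'" "compose (carrier Y') h f = i'" "compose (carrier X) h g = j'"
        unfolding amalgam_iso_def by auto
      obtain k where k: "k \<in> isos X' (W g)" "\<And>x. x \<in> carrier (W g) \<Longrightarrow> k (h x) = x"
        using isos_inverse[OF h(1)] by blast
      have sub: "f ` carrier Y' \<union> g ` carrier X \<subseteq> carrier \<Gamma>"
        using f ge by (auto simp: embeddings_iff)
      define k' where "k' = compose (carrier X') (\<lambda>x \<in> f ` carrier Y' \<union> g ` carrier X. x) k"
      have k': "k' \<in> embeddings X' \<Gamma>"
        unfolding k'_def
        by (rule embeddings_compose[OF _ induced_inclusion[OF sub]]) (use k(1) in \<open>simp add: isos_iff_embeddings W_def\<close>)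
      have hk: "h x \<in> carrier X'" "k' (h x) = x" if "x \<in> f ` carrier Y' \<union> g ` carrier X" for x
      proof -
        have x: "x \<in> carrier (W g)"
          using that by (simp add: W_def induced_def)
        then show "h x \<in> carrier X'"
          using h(1) by (auto simp: isos_def)
        then show "k' (h x) = x"
          using k(2)[OF x] that by (simp add: k'_def compose_eq)
      qed
      have "compose (carrier Y') k' i' = f"
      proof
        fix y show "compose (carrier Y') k' i' y = f y"
          using f hk(2) unfolding h(2)[symmetric]
          by (cases "y \<in> carrier Y'") (auto simp: compose_def embeddings_iff)
      qed
      then have "k' \<in> extensions \<Gamma> Y' i' X' f"
        using k' by (simp add: extensions_def)
      moreover have "compose (carrier X) k' j' = g"
      proof
        fix x show "compose (carrier X) k' j' x = g x"
          using ge hk(2) unfolding h(3)[symmetric]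
          by (cases "x \<in> carrier X") (auto simp: compose_def embeddings_iff)
      qed
      ultimately have "((X', i', j'), k') \<in> ?D" "g = ?F ((X', i', j'), k')"
        using t(1) by simp_all
      then show "g \<in> ?F ` ?D"
        by (rule rev_image_eqI)
    qed
  qed
qed


section \<open>The filter of large homogeneous structures\<close>

definition embedding_ratio :: "('a, 'r) rel_struct \<Rightarrow> ('a, 'r) arrow \<Rightarrow> rat"
  where "embedding_ratio \<Gamma> = (\<lambda>(Y, i, X). of_nat (card (embeddings X \<Gamma>)) / of_nat (card (embeddings Y \<Gamma>)))"

text \<open>
  If \<open>\<AA>\<close> is non-empty, a property holds eventually for this filter iff there are finitely many objects
  of \<open>\<AA>\<close> such that it holds for all homogeneous objects of \<open>\<AA>\<close> that contain them.  For empty \<open>\<AA>\<close> the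
  filter is \<open>top\<close>, which is still proper, so the same argument covers this case.
\<close>
definition homogeneous_germs :: "('a, 'r) rel_struct set \<Rightarrow> ('a, 'r) rel_struct filter"
  where "homogeneous_germs \<AA> =
    (INF X \<in> \<AA>. principal {\<Gamma> \<in> \<AA>. homogeneous \<AA> \<Gamma> \<and> embeddings X \<Gamma> \<noteq> {}})"

lemma eventually_homogeneous_germs:
  "X \<in> \<AA> \<Longrightarrow> \<forall>\<^sub>F \<Gamma> in homogeneous_germs \<AA>. \<Gamma> \<in> \<AA> \<and> homogeneous \<AA> \<Gamma> \<and> embeddings X \<Gamma> \<noteq> {}"
  unfolding homogeneous_germs_def by (rule eventually_INF1) (auto simp: eventually_principal)

text \<open>
  Amalgamate over the empty structure.  It embeds into both objects because arities are positive: a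
  nullary relation could hold in one object and fail in the other.
\<close>
lemma joint_embedding:
  assumes "signature \<sigma>" "fraisse_class \<sigma> \<AA>" "X \<in> \<AA>" "Y \<in> \<AA>"
  obtains Z where "Z \<in> \<AA>" "embeddings X Z \<noteq> {}" "embeddings Y Z \<noteq> {}"
proof -
  let ?E = "induced X {}"
  have E: "?E \<in> \<AA>"
    using assms(2,3) unfolding fraisse_class_def by blast
  have nil: "[] \<notin> interp W r" if "W \<in> \<AA>" for W r
  proof
    assume "[] \<in> interp W r"
    then have "\<sigma> r = Some 0"
      using that assms(2) unfolding fraisse_class_def structure_over_def by fastforce
    then show False
      using assms(1) unfolding signature_def by (auto dest: ranI)
  qed
  \<comment> \<open>On the empty carrier, the only extensional function is constantly \<open>undefined\<close>.\<close>
  have emb: "(\<lambda>x. undefined) \<in> embeddings ?E W" if "W \<in> \<AA>" for W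
    using nil[OF that] nil[OF assms(3)] unfolding embeddings_iff induced_def by auto
  have amalgamates: "\<forall>Y \<in> \<AA>. \<forall>X \<in> \<AA>. \<forall>Y' \<in> \<AA>. \<forall>i \<in> embeddings Y X. \<forall>j \<in> embeddings Y Y'.
      amalgamations \<AA> Y X Y' i j \<noteq> {}"
    using assms(2) unfolding fraisse_class_def by (elim conjE)
  have "amalgamations \<AA> ?E X Y (\<lambda>x. undefined) (\<lambda>x. undefined) \<noteq> {}"
    using amalgamates E assms(3,4) emb by simp
  then show ?thesis
    using that unfolding amalgamations_def by blast
qed

text \<open>
  Joint embedding makes the base of the filter directed, and smooth approximation makes each of its
  members non-empty.
\<close>
lemma homogeneous_germs_not_bot:
  assumes "signature \<sigma>" "fraisse_class \<sigma> \<AA>" "smoothly_approximable \<AA>"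
  shows "homogeneous_germs \<AA> \<noteq> bot"
proof -
  let ?H = "\<lambda>X. {\<Gamma> \<in> \<AA>. homogeneous \<AA> \<Gamma> \<and> embeddings X \<Gamma> \<noteq> {}}"
  have "\<exists>Z \<in> \<AA>. principal (?H Z) \<le> inf (principal (?H X)) (principal (?H Y))"
    if XY: "X \<in> \<AA>" "Y \<in> \<AA>" for X Y
  proof -
    obtain Z where Z: "Z \<in> \<AA>" "embeddings X Z \<noteq> {}" "embeddings Y Z \<noteq> {}"
      using joint_embedding[OF assms(1,2) XY] .
    then have "?H Z \<subseteq> ?H X \<inter> ?H Y"
      using embeddings_compose[of _ X Z] embeddings_compose[of _ Y Z] by blast
    with Z(1) show ?thesis
      by auto
  qed
  then have "homogeneous_germs \<AA> = bot \<longleftrightarrow> (\<exists>X \<in> \<AA>. principal (?H X) = bot)"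
    unfolding homogeneous_germs_def by (rule INF_filter_bot_base)
  moreover have "?H X \<noteq> {}" if "X \<in> \<AA>" for X
    using assms(3) that unfolding smoothly_approximable_def by blast
  ultimately show ?thesis
    by (auto simp: principal_eq_bot_iff)
qed

lemma embedding_ratio_extensions:
  assumes "homogeneous \<AA> \<Gamma>" "finite (carrier \<Gamma>)" "finite (carrier X)" "finite (carrier Y)"
    "Y \<in> \<AA>" "i \<in> embeddings Y X" "f \<in> embeddings Y \<Gamma>"
  shows "embedding_ratio \<Gamma> (Y, i, X) = of_nat (card (extensions \<Gamma> Y i X f))"
proof -
  have "card (embeddings Y \<Gamma>) \<noteq> 0"
    using assms(7) finite_embeddings[OF assms(4,2)] by (metis card_0_eq empty_iff)
  moreover have "rat_of_nat (card (extensions \<Gamma> Y i X f)) * of_nat (card (embeddings Y \<Gamma>)) = of_nat (card (embeddings X \<Gamma>))"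
    unfolding of_nat_mult[symmetric] card_extensions[OF assms] ..
  ultimately show ?thesis
    by (simp add: embedding_ratio_def divide_eq_eq)
qed


section \<open>Homomorphisms to germs of rational functions\<close>

text \<open>
  The family \<open>\<phi>\<close> stands for the map sending \<open>x\<close> to the germ of \<open>i \<mapsto> \<phi> i x\<close> along \<open>F\<close>, and the
  conditions say that this map is a homomorphism.  No single \<open>\<phi> i\<close> needs to be one, as the set of good
  indices may depend on the elements involved.
\<close>
definition germ_additive :: "'i filter \<Rightarrow> ('b, 'm) monoid_scheme \<Rightarrow> ('i \<Rightarrow> 'b \<Rightarrow> rat) \<Rightarrow> bool"
  where "germ_additive F G \<phi> \<longleftrightarrow> (\<forall>x \<in> carrier G. \<forall>y \<in> carrier G.
    \<forall>\<^sub>F i in F. \<phi> i (x \<otimes>\<^bsub>G\<^esub> y) = \<phi> i x + \<phi> i y)"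

definition germ_ring_hom :: "'i filter \<Rightarrow> ('b, 'm) ring_scheme \<Rightarrow> ('i \<Rightarrow> 'b \<Rightarrow> rat) \<Rightarrow> bool"
  where "germ_ring_hom F R \<phi> \<longleftrightarrow> germ_additive F (add_monoid R) \<phi> \<and>
    (\<forall>x \<in> carrier R. \<forall>y \<in> carrier R. \<forall>\<^sub>F i in F. \<phi> i (x \<otimes>\<^bsub>R\<^esub> y) = \<phi> i x * \<phi> i y) \<and>
    (\<forall>\<^sub>F i in F. \<phi> i \<one>\<^bsub>R\<^esub> = 1)"

lemma germ_additiveD:
  "germ_additive F G \<phi> \<Longrightarrow> x \<in> carrier G \<Longrightarrow> y \<in> carrier G \<Longrightarrow>
    \<forall>\<^sub>F i in F. \<phi> i (x \<otimes>\<^bsub>G\<^esub> y) = \<phi> i x + \<phi> i y"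
  unfolding germ_additive_def by blast

lemma germ_ring_homD:
  assumes "germ_ring_hom F R \<phi>"
  shows germ_ring_hom_add: "x \<in> carrier R \<Longrightarrow> y \<in> carrier R \<Longrightarrow>
      \<forall>\<^sub>F i in F. \<phi> i (x \<oplus>\<^bsub>R\<^esub> y) = \<phi> i x + \<phi> i y"
    and germ_ring_hom_mult: "x \<in> carrier R \<Longrightarrow> y \<in> carrier R \<Longrightarrow>
      \<forall>\<^sub>F i in F. \<phi> i (x \<otimes>\<^bsub>R\<^esub> y) = \<phi> i x * \<phi> i y"
    and germ_ring_hom_one: "\<forall>\<^sub>F i in F. \<phi> i \<one>\<^bsub>R\<^esub> = 1"
  using assms unfolding germ_ring_hom_def germ_additive_def by simp_all

lemma germ_ring_hom_zero:
  fixes R (structure)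
  assumes "ring R" "germ_ring_hom F R \<phi>"
  shows "\<forall>\<^sub>F i in F. \<phi> i \<zero>\<^bsub>R\<^esub> = 0"
proof -
  interpret ring R by fact
  show ?thesis
    using germ_ring_hom_add[OF assms(2) zero_closed zero_closed] by eventually_elim simp
qed

lemma germ_ring_hom_a_inv:
  fixes R (structure)
  assumes "ring R" "germ_ring_hom F R \<phi>" "x \<in> carrier R"
  shows "\<forall>\<^sub>F i in F. \<phi> i (\<ominus>\<^bsub>R\<^esub> x) = - \<phi> i x"
proof -
  interpret ring R by fact
  show ?thesis
    using germ_ring_hom_add[OF assms(2) a_inv_closed[OF assms(3)] assms(3)]
      germ_ring_hom_zero[OF assms(1,2)]
    by eventually_elim (use assms(3) in \<open>simp add: l_neg eq_neg_iff_add_eq_0\<close>)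
qed

lemma germ_kernel_ideal:
  fixes R (structure)
  assumes "ring R" "germ_ring_hom F R \<phi>"
  shows "ideal {x \<in> carrier R. \<forall>\<^sub>F i in F. \<phi> i x = 0} R" (is "ideal ?K R")
proof -
  interpret ring R by fact
  note hom = assms(2)
  show ?thesis
  proof (rule idealI[OF assms(1)])
    show "subgroup ?K (add_monoid R)"
    proof (rule subgroup.intro)
      fix x y assume xy: "x \<in> ?K" "y \<in> ?K"
      then have "\<forall>\<^sub>F i in F. \<phi> i x = 0" "\<forall>\<^sub>F i in F. \<phi> i y = 0"
        "\<forall>\<^sub>F i in F. \<phi> i (x \<oplus> y) = \<phi> i x + \<phi> i y"
        using germ_ring_hom_add[OF hom, of x y] by auto
      then have "\<forall>\<^sub>F i in F. \<phi> i (x \<oplus> y) = 0"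
        by eventually_elim simp
      with xy show "x \<otimes>\<^bsub>add_monoid R\<^esub> y \<in> ?K"
        by simp
    next
      fix x assume x: "x \<in> ?K"
      then have "\<forall>\<^sub>F i in F. \<phi> i x = 0" "\<forall>\<^sub>F i in F. \<phi> i (\<ominus> x) = - \<phi> i x"
        using germ_ring_hom_a_inv[OF assms, of x] by auto
      then have "\<forall>\<^sub>F i in F. \<phi> i (\<ominus> x) = 0"
        by eventually_elim simp
      then show "inv\<^bsub>add_monoid R\<^esub> x \<in> ?K"
        using x by (simp add: a_inv_def[symmetric])
    qed (use germ_ring_hom_zero[OF assms] in auto)
  next
    fix a x assume ax: "a \<in> ?K" "x \<in> carrier R"
    then have a: "\<forall>\<^sub>F i in F. \<phi> i a = 0" "a \<in> carrier R"
      by auto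
    have "\<forall>\<^sub>F i in F. \<phi> i (x \<otimes> a) = 0"
      using a(1) germ_ring_hom_mult[OF hom ax(2) a(2)] by eventually_elim simp
    moreover have "\<forall>\<^sub>F i in F. \<phi> i (a \<otimes> x) = 0"
      using a(1) germ_ring_hom_mult[OF hom a(2) ax(2)] by eventually_elim simp
    ultimately show "x \<otimes> a \<in> ?K" "a \<otimes> x \<in> ?K"
      using ax by auto
  qed
qed

text \<open>
  The homomorphism induced on a quotient evaluates \<open>\<phi> i\<close> at an arbitrary representative of a coset.
  The choice changes the value only on a set of indices that is negligible for \<open>F\<close>.
\<close>
lemma germ_ring_hom_coset:
  fixes R (structure)
  assumes "ideal I R" "germ_ring_hom F R \<phi>" "\<And>x. x \<in> I \<Longrightarrow> \<forall>\<^sub>F i in F. \<phi> i x = 0"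
    and p: "p \<in> carrier R"
  shows "\<forall>\<^sub>F i in F. \<phi> i (SOME q. q \<in> I +>\<^bsub>R\<^esub> p) = \<phi> i p"
proof -
  interpret ideal I R by fact
  have "(SOME q. q \<in> I +> p) \<in> I +> p"
    using a_rcos_self[OF p] by (rule someI)
  then obtain a where a: "a \<in> I" "(SOME q. q \<in> I +> p) = a \<oplus> p"
    unfolding a_r_coset_def' by auto
  show ?thesis
    using assms(3)[OF a(1)] germ_ring_hom_add[OF assms(2) a_Hcarr[OF a(1)] p]
    by eventually_elim (simp add: a(2))
qed

lemma germ_ring_hom_Quot:
  fixes R (structure)
  assumes I: "ideal I R" and hom: "germ_ring_hom F R \<phi>"
    and zero: "\<And>x. x \<in> I \<Longrightarrow> \<forall>\<^sub>F i in F. \<phi> i x = 0"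
  shows "germ_ring_hom F (R Quot I) (\<lambda>i A. \<phi> i (SOME q. q \<in> A))"
proof -
  interpret ideal I R by fact
  have val: "\<forall>\<^sub>F i in F. \<phi> i (SOME q. q \<in> I +> p) = \<phi> i p" if "p \<in> carrier R" for p
    using germ_ring_hom_coset[OF I hom zero that] .
  have rep: "\<exists>x \<in> carrier R. A = I +> x" if "A \<in> carrier (R Quot I)" for A
    using that unfolding FactRing_def A_RCOSETS_def' by auto
  show ?thesis
    unfolding germ_ring_hom_def germ_additive_def
  proof (intro conjI ballI)
    fix A B assume "A \<in> carrier (add_monoid (R Quot I))" "B \<in> carrier (add_monoid (R Quot I))"
    then obtain x y where [simp]: "x \<in> carrier R" "y \<in> carrier R" "A = I +> x" "B = I +> y"
      using rep[of A] rep[of B] by auto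
    have sum: "A \<otimes>\<^bsub>add_monoid (R Quot I)\<^esub> B = I +> (x \<oplus> y)"
      by (simp add: FactRing_def a_rcos_sum)
    show "\<forall>\<^sub>F i in F. \<phi> i (SOME q. q \<in> A \<otimes>\<^bsub>add_monoid (R Quot I)\<^esub> B) =
        \<phi> i (SOME q. q \<in> A) + \<phi> i (SOME q. q \<in> B)"
      using val[of x, simplified] val[of y, simplified] val[of "x \<oplus> y", simplified]
        germ_ring_hom_add[OF hom, of x y, simplified]
      unfolding sum by eventually_elim simp
  next
    fix A B assume "A \<in> carrier (R Quot I)" "B \<in> carrier (R Quot I)"
    then obtain x y where [simp]: "x \<in> carrier R" "y \<in> carrier R" "A = I +> x" "B = I +> y"
      using rep[of A] rep[of B] by auto
    have prod: "A \<otimes>\<^bsub>R Quot I\<^esub> B = I +> (x \<otimes> y)"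
      by (simp add: FactRing_def rcoset_mult_add)
    show "\<forall>\<^sub>F i in F. \<phi> i (SOME q. q \<in> A \<otimes>\<^bsub>R Quot I\<^esub> B) =
        \<phi> i (SOME q. q \<in> A) * \<phi> i (SOME q. q \<in> B)"
      using val[of x, simplified] val[of y, simplified] val[of "x \<otimes> y", simplified]
        germ_ring_hom_mult[OF hom, of x y, simplified]
      unfolding prod by eventually_elim simp
  next
    show "\<forall>\<^sub>F i in F. \<phi> i (SOME q. q \<in> \<one>\<^bsub>R Quot I\<^esub>) = 1"
      using val[OF one_closed] germ_ring_hom_one[OF hom]
      by eventually_elim (simp add: FactRing_def)
  qed
qed


section \<open>Germs on rings of fractions\<close>

lemma submonoid_submonoid_generated:
  fixes R (structure)
  assumes "monoid R" "S \<subseteq> carrier R"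
  shows "submonoid (submonoid_generated R S) R"
proof -
  interpret monoid R by fact
  have "submonoid (carrier R) R"
    by (rule submonoid.intro) auto
  then have sub: "submonoid_generated R S \<subseteq> carrier R"
    using assms(2) unfolding submonoid_generated_def by blast
  show ?thesis
  proof (rule submonoid.intro[OF sub])
    fix x y assume "x \<in> submonoid_generated R S" "y \<in> submonoid_generated R S"
    then show "x \<otimes> y \<in> submonoid_generated R S"
      unfolding submonoid_generated_def by (auto intro: submonoid.m_closed)
  qed (auto simp: submonoid_generated_def intro: submonoid.one_closed)
qed

lemma frac_relD:
  assumes "((r, s), (r', s')) \<in> frac_rel R M"
  shows "r \<in> carrier R" "s \<in> M" "r' \<in> carrier R" "s' \<in> M"
    "\<exists>u \<in> M. u \<otimes>\<^bsub>R\<^esub> (r \<otimes>\<^bsub>R\<^esub> s') = u \<otimes>\<^bsub>R\<^esub> (r' \<otimes>\<^bsub>R\<^esub> s)"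
  using assms unfolding frac_rel_def by auto

lemma equiv_frac_rel:
  fixes R (structure)
  assumes "cring R" "submonoid M R"
  shows "equiv (carrier R \<times> M) (frac_rel R M)"
proof -
  interpret cring R by fact
  interpret submonoid M R by fact
  have M: "x \<in> carrier R" if "x \<in> M" for x
    using that subset by blast
  have "trans (frac_rel R M)"
  proof (rule transI, clarify)
    fix r s r' s' r'' s''
    assume a: "((r, s), (r', s')) \<in> frac_rel R M" and b: "((r', s'), (r'', s'')) \<in> frac_rel R M"
    obtain u v where u: "u \<in> M" "u \<otimes> (r \<otimes> s') = u \<otimes> (r' \<otimes> s)"
      and v: "v \<in> M" "v \<otimes> (r' \<otimes> s'') = v \<otimes> (r'' \<otimes> s')"
      using frac_relD(5)[OF a] frac_relD(5)[OF b] by blast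
    note c = frac_relD(1-4)[OF a] frac_relD(1-4)[OF b]
    note [simp] = c M[OF c(2)] M[OF c(4)] M[OF c(8)] M[OF u(1)] M[OF v(1)]
    \<comment> \<open>Both given equations are about fractions over \<open>s'\<close>, so this denominator has to be cleared too.\<close>
    have "(u \<otimes> v \<otimes> s') \<otimes> (r \<otimes> s'') = (v \<otimes> s'') \<otimes> (u \<otimes> (r \<otimes> s'))"
      by (simp add: m_ac)
    also have "\<dots> = (u \<otimes> s) \<otimes> (v \<otimes> (r' \<otimes> s''))"
      unfolding u(2) by (simp add: m_ac)
    also have "\<dots> = (u \<otimes> v \<otimes> s') \<otimes> (r'' \<otimes> s)"
      unfolding v(2) by (simp add: m_ac)
    finally show "((r, s), (r'', s'')) \<in> frac_rel R M"
      unfolding frac_rel_def using u(1) v(1) by (auto intro!: bexI[of _ "u \<otimes> v \<otimes> s'"])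
  qed
  moreover have "sym (frac_rel R M)"
    unfolding frac_rel_def by (rule symI) (auto intro: sym)
  moreover have "refl_on (carrier R \<times> M) (frac_rel R M)"
    unfolding frac_rel_def by (rule refl_onI) auto
  moreover have "frac_rel R M \<subseteq> (carrier R \<times> M) \<times> (carrier R \<times> M)"
    unfolding frac_rel_def by auto
  ultimately show ?thesis
    by (auto intro: equivI)
qed

lemma frac_rel_add:
  fixes R (structure)
  assumes "cring R" "submonoid M R"
    and a: "((r, s), (a, b)) \<in> frac_rel R M" and b: "((r', s'), (a', b')) \<in> frac_rel R M"
  shows "((r \<otimes>\<^bsub>R\<^esub> s' \<oplus>\<^bsub>R\<^esub> r' \<otimes>\<^bsub>R\<^esub> s, s \<otimes>\<^bsub>R\<^esub> s'), (a \<otimes>\<^bsub>R\<^esub> b' \<oplus>\<^bsub>R\<^esub> a' \<otimes>\<^bsub>R\<^esub> b, b \<otimes>\<^bsub>R\<^esub> b')) \<in> frac_rel R M"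
proof -
  interpret cring R by fact
  interpret submonoid M R by fact
  have M: "x \<in> carrier R" if "x \<in> M" for x
    using that subset by blast
  obtain u v where u: "u \<in> M" "u \<otimes> (r \<otimes> b) = u \<otimes> (a \<otimes> s)"
    and v: "v \<in> M" "v \<otimes> (r' \<otimes> b') = v \<otimes> (a' \<otimes> s')"
    using frac_relD(5)[OF a] frac_relD(5)[OF b] by blast
  note c = frac_relD(1-4)[OF a] frac_relD(1-4)[OF b]
  note [simp] = c M[OF c(2)] M[OF c(4)] M[OF c(6)] M[OF c(8)] M[OF u(1)] M[OF v(1)]
  have "(u \<otimes> v) \<otimes> ((r \<otimes> s' \<oplus> r' \<otimes> s) \<otimes> (b \<otimes> b')) =
      (v \<otimes> s' \<otimes> b') \<otimes> (u \<otimes> (r \<otimes> b)) \<oplus> (u \<otimes> s \<otimes> b) \<otimes> (v \<otimes> (r' \<otimes> b'))"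
    by (simp add: l_distr r_distr m_ac)
  also have "\<dots> = (u \<otimes> v) \<otimes> ((a \<otimes> b' \<oplus> a' \<otimes> b) \<otimes> (s \<otimes> s'))"
    unfolding u(2) v(2) by (simp add: l_distr r_distr m_ac)
  finally show ?thesis
    unfolding frac_rel_def using u(1) v(1) by (auto intro!: bexI[of _ "u \<otimes> v"])
qed

lemma ring_of_fractions_add:
  fixes R (structure)
  assumes "cring R" "submonoid M R" "r \<in> carrier R" "s \<in> M" "r' \<in> carrier R" "s' \<in> M"
  shows "frac_rel R M `` {(r, s)} \<oplus>\<^bsub>ring_of_fractions R M\<^esub> frac_rel R M `` {(r', s')} =
    frac_rel R M `` {(r \<otimes>\<^bsub>R\<^esub> s' \<oplus>\<^bsub>R\<^esub> r' \<otimes>\<^bsub>R\<^esub> s, s \<otimes>\<^bsub>R\<^esub> s')}"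
proof -
  note eq = equiv_frac_rel[OF assms(1,2)]
  have self: "((r, s), (r, s)) \<in> frac_rel R M" "((r', s'), (r', s')) \<in> frac_rel R M"
    using equiv_class_self[OF eq, of "(r, s)"] equiv_class_self[OF eq, of "(r', s')"] assms by auto
  let ?A = "frac_rel R M `` {(r, s)}" and ?B = "frac_rel R M `` {(r', s')}"
  let ?C = "frac_rel R M `` {(r \<otimes> s' \<oplus> r' \<otimes> s, s \<otimes> s')}"
  let ?f = "\<lambda>p q. frac_rel R M `` {(fst p \<otimes> snd q \<oplus> fst q \<otimes> snd p, snd p \<otimes> snd q)}"
  have f: "?f p q = ?C" if "p \<in> ?A" "q \<in> ?B" for p q
  proof -
    obtain a b a' b' where [simp]: "p = (a, b)" "q = (a', b')"
      by fastforce
    have "((r, s), (a, b)) \<in> frac_rel R M" "((r', s'), (a', b')) \<in> frac_rel R M"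
      using that by simp_all
    from equiv_class_eq[OF eq frac_rel_add[OF assms(1,2) this]] show ?thesis
      by simp
  qed
  have ne: "?A \<noteq> {}" "?B \<noteq> {}"
    using self by blast+
  have "(\<Union>q \<in> ?B. ?f p q) = ?C" if "p \<in> ?A" for p
    by (rule SUP_eq_const[OF ne(2) f[OF that]])
  then have "(\<Union>p \<in> ?A. \<Union>q \<in> ?B. ?f p q) = ?C"
    by (rule SUP_eq_const[OF ne(1)])
  then show ?thesis
    unfolding ring_of_fractions_def by (simp add: case_prod_beta)
qed

definition frac_value :: "('i \<Rightarrow> 'b \<Rightarrow> rat) \<Rightarrow> 'i \<Rightarrow> ('b \<times> 'b) set \<Rightarrow> rat"
  where "frac_value \<phi> i A = (case SOME x. x \<in> A of (r, s) \<Rightarrow> \<phi> i r / \<phi> i s)"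

text \<open>
  The universal property of localization, with germs as target.  Elements with eventually non-zero
  value form a submonoid, so all denominators have this property, and the value \<open>\<phi> i r / \<phi> i s\<close> of a
  fraction depends eventually only on its class.  Only additivity is recorded, since this is what a
  tensor product of abelian groups sees.
\<close>
lemma germ_localization:
  fixes R (structure) and \<phi> :: "'i \<Rightarrow> 'b \<Rightarrow> rat"
  assumes R: "cring R" and hom: "germ_ring_hom F R \<phi>" and S: "S \<subseteq> carrier R"
    and unit: "\<And>s. s \<in> S \<Longrightarrow> \<forall>\<^sub>F i in F. \<phi> i s \<noteq> 0"
  shows germ_localization_closed: "\<And>x y. x \<in> carrier (localization R S) \<Longrightarrow> y \<in> carrier (localization R S) \<Longrightarrow>
      x \<oplus>\<^bsub>localization R S\<^esub> y \<in> carrier (localization R S)"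
    and germ_localization_one_closed: "\<one>\<^bsub>localization R S\<^esub> \<in> carrier (localization R S)"
    and germ_localization_additive: "germ_additive F (add_monoid (localization R S)) (frac_value \<phi>)"
    and germ_localization_one: "\<forall>\<^sub>F i in F. frac_value \<phi> i \<one>\<^bsub>localization R S\<^esub> = 1"
proof -
  interpret cring R by fact
  define M where "M = submonoid_generated R S"
  have M: "submonoid M R"
    unfolding M_def by (rule submonoid_submonoid_generated[OF monoid_axioms S])
  interpret submonoid M R by fact
  have Mc: "x \<in> carrier R" if "x \<in> M" for x
    using that subset by blast
  note eq = equiv_frac_rel[OF R M]
  have "submonoid {x \<in> carrier R. \<forall>\<^sub>F i in F. \<phi> i x \<noteq> 0} R"
  proof (rule submonoid.intro)
    show "\<one> \<in> {x \<in> carrier R. \<forall>\<^sub>F i in F. \<phi> i x \<noteq> 0}"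
      using germ_ring_hom_one[OF hom] by (auto elim: eventually_mono)
  next
    fix x y assume xy: "x \<in> {x \<in> carrier R. \<forall>\<^sub>F i in F. \<phi> i x \<noteq> 0}" "y \<in> {x \<in> carrier R. \<forall>\<^sub>F i in F. \<phi> i x \<noteq> 0}"
    then have "\<forall>\<^sub>F i in F. \<phi> i x \<noteq> 0" "\<forall>\<^sub>F i in F. \<phi> i y \<noteq> 0"
        "\<forall>\<^sub>F i in F. \<phi> i (x \<otimes> y) = \<phi> i x * \<phi> i y"
      using germ_ring_hom_mult[OF hom, of x y] by auto
    then have "\<forall>\<^sub>F i in F. \<phi> i (x \<otimes> y) \<noteq> 0"
      by eventually_elim simp
    then show "x \<otimes> y \<in> {x \<in> carrier R. \<forall>\<^sub>F i in F. \<phi> i x \<noteq> 0}"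
      using xy by auto
  qed auto
  moreover have "S \<subseteq> {x \<in> carrier R. \<forall>\<^sub>F i in F. \<phi> i x \<noteq> 0}"
    using S unit by blast
  ultimately have "M \<subseteq> {x \<in> carrier R. \<forall>\<^sub>F i in F. \<phi> i x \<noteq> 0}"
    unfolding M_def submonoid_generated_def by (intro Inter_lower) simp
  then have nz: "\<forall>\<^sub>F i in F. \<phi> i s \<noteq> 0" if "s \<in> M" for s
    using that by blast
  have val: "\<forall>\<^sub>F i in F. frac_value \<phi> i (frac_rel R M `` {(r, s)}) = \<phi> i r / \<phi> i s"
    if rs: "r \<in> carrier R" "s \<in> M" for r s
  proof -
    obtain a b where ab: "(SOME x. x \<in> frac_rel R M `` {(r, s)}) = (a, b)"
      by fastforce
    have "(r, s) \<in> frac_rel R M `` {(r, s)}"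
      using equiv_class_self[OF eq, of "(r, s)"] rs by auto
    then have "(a, b) \<in> frac_rel R M `` {(r, s)}"
      unfolding ab[symmetric] by (rule someI)
    then have rel: "((r, s), (a, b)) \<in> frac_rel R M"
      by simp
    then obtain u where u: "u \<in> M" "u \<otimes> (r \<otimes> b) = u \<otimes> (a \<otimes> s)"
      using frac_relD(5)[OF rel] by blast
    note c = frac_relD(1-4)[OF rel]
    note cc = Mc[OF c(2)] Mc[OF c(4)] Mc[OF u(1)]
    have "\<forall>\<^sub>F i in F. \<phi> i (u \<otimes> (r \<otimes> b)) = \<phi> i u * \<phi> i (r \<otimes> b)"
      "\<forall>\<^sub>F i in F. \<phi> i (r \<otimes> b) = \<phi> i r * \<phi> i b"
      "\<forall>\<^sub>F i in F. \<phi> i (u \<otimes> (a \<otimes> s)) = \<phi> i u * \<phi> i (a \<otimes> s)"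
      "\<forall>\<^sub>F i in F. \<phi> i (a \<otimes> s) = \<phi> i a * \<phi> i s"
      using c cc by (auto intro!: germ_ring_hom_mult[OF hom])
    then show ?thesis
      using nz[OF c(2)] nz[OF c(4)] nz[OF u(1)]
      unfolding frac_value_def ab
      by eventually_elim (use u(2) in \<open>auto simp: field_simps\<close>)
  qed
  have loc: "localization R S = ring_of_fractions R M"
    unfolding localization_def M_def ..
  have car: "carrier (ring_of_fractions R M) = (carrier R \<times> M) // frac_rel R M"
    by (simp add: ring_of_fractions_def)
  have rep: "\<exists>r s. r \<in> carrier R \<and> s \<in> M \<and> A = frac_rel R M `` {(r, s)}"
    if "A \<in> carrier (localization R S)" for A
    using that unfolding loc car by (auto elim!: quotientE)
  show closed: "x \<oplus>\<^bsub>localization R S\<^esub> y \<in> carrier (localization R S)"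
    if xy: "x \<in> carrier (localization R S)" "y \<in> carrier (localization R S)" for x y
  proof -
    obtain r s r' s' where "r \<in> carrier R" "s \<in> M" "x = frac_rel R M `` {(r, s)}"
      "r' \<in> carrier R" "s' \<in> M" "y = frac_rel R M `` {(r', s')}"
      using rep[OF xy(1)] rep[OF xy(2)] by blast
    then show ?thesis
      unfolding loc by (simp add: ring_of_fractions_add[OF R M] car quotientI Mc)
  qed
  show "\<one>\<^bsub>localization R S\<^esub> \<in> carrier (localization R S)"
    unfolding loc car by (simp add: ring_of_fractions_def quotientI)
  show "\<forall>\<^sub>F i in F. frac_value \<phi> i \<one>\<^bsub>localization R S\<^esub> = 1"
    unfolding loc using val[OF Mc[OF one_closed] one_closed] germ_ring_hom_one[OF hom]
    by eventually_elim (simp add: ring_of_fractions_def)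
  show "germ_additive F (add_monoid (localization R S)) (frac_value \<phi>)"
    unfolding germ_additive_def
  proof (intro ballI)
    fix x y assume "x \<in> carrier (add_monoid (localization R S))" "y \<in> carrier (add_monoid (localization R S))"
    then obtain r s r' s' where rs: "r \<in> carrier R" "s \<in> M" "x = frac_rel R M `` {(r, s)}"
      "r' \<in> carrier R" "s' \<in> M" "y = frac_rel R M `` {(r', s')}"
      using rep[of x] rep[of y] by auto
    note cc = rs(1,2,4,5) Mc[OF rs(2)] Mc[OF rs(5)]
    have sum: "x \<otimes>\<^bsub>add_monoid (localization R S)\<^esub> y = frac_rel R M `` {(r \<otimes> s' \<oplus> r' \<otimes> s, s \<otimes> s')}"
      unfolding loc using rs by (simp add: ring_of_fractions_add[OF R M])
    have "\<forall>\<^sub>F i in F. \<phi> i (r \<otimes> s' \<oplus> r' \<otimes> s) = \<phi> i (r \<otimes> s') + \<phi> i (r' \<otimes> s)"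
      "\<forall>\<^sub>F i in F. \<phi> i (r \<otimes> s') = \<phi> i r * \<phi> i s'"
      "\<forall>\<^sub>F i in F. \<phi> i (r' \<otimes> s) = \<phi> i r' * \<phi> i s"
      "\<forall>\<^sub>F i in F. \<phi> i (s \<otimes> s') = \<phi> i s * \<phi> i s'"
      "\<forall>\<^sub>F i in F. frac_value \<phi> i (frac_rel R M `` {(r \<otimes> s' \<oplus> r' \<otimes> s, s \<otimes> s')})
        = \<phi> i (r \<otimes> s' \<oplus> r' \<otimes> s) / \<phi> i (s \<otimes> s')"
      using cc by (auto intro!: germ_ring_hom_mult[OF hom] germ_ring_hom_add[OF hom] val)
    then show "\<forall>\<^sub>F i in F. frac_value \<phi> i (x \<otimes>\<^bsub>add_monoid (localization R S)\<^esub> y) =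
        frac_value \<phi> i x + frac_value \<phi> i y"
      using val[OF rs(1,2)] val[OF rs(4,5)] nz[OF rs(2)] nz[OF rs(5)] unfolding sum
      by eventually_elim (simp add: rs(3,6) add_frac_eq)
  qed
qed


section \<open>The tensor product with the rational numbers\<close>

definition linear_extension :: "('x \<Rightarrow> rat) \<Rightarrow> ('x \<Rightarrow>\<^sub>0 int) \<Rightarrow> rat"
  where "linear_extension f c = (\<Sum>x \<in> Poly_Mapping.keys c. of_int (Poly_Mapping.lookup c x) * f x)"

lemma linear_extension_superset:
  assumes "finite A" "Poly_Mapping.keys c \<subseteq> A"
  shows "linear_extension f c = (\<Sum>x \<in> A. of_int (Poly_Mapping.lookup c x) * f x)"
  unfolding linear_extension_def using assms
  by (intro sum.mono_neutral_left) (auto simp: in_keys_iff)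

lemma linear_extension_diff: "linear_extension f (c - d) = linear_extension f c - linear_extension f d"
proof -
  let ?A = "Poly_Mapping.keys c \<union> Poly_Mapping.keys d"
  have "Poly_Mapping.keys (c - d) \<subseteq> ?A"
    by (rule keys_diff)
  then show ?thesis
    by (simp add: linear_extension_superset[where A = ?A] lookup_minus sum_subtractf[symmetric] left_diff_distrib)
qed

lemma linear_extension_zero [simp]: "linear_extension f 0 = 0"
  by (simp add: linear_extension_def)

lemma linear_extension_minus: "linear_extension f (- c) = - linear_extension f c"
  using linear_extension_diff[of f 0 c] by simp

lemma linear_extension_add: "linear_extension f (c + d) = linear_extension f c + linear_extension f d"
  using linear_extension_diff[of f c "- d"] by (simp add: linear_extension_minus)

lemma linear_extension_of [simp]: "linear_extension f (frag_of x) = f x"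
  by (simp add: linear_extension_def)

lemma linear_extension_sum: "linear_extension f (sum g T) = (\<Sum>t \<in> T. linear_extension f (g t))"
  by (induction T rule: infinite_finite_induct) (simp_all add: linear_extension_add)

text \<open>
  The pairing \<open>(x, y) \<mapsto> \<psi>(x) y\<close> with values in germs is bilinear, so its linear extension kills
  the subgroup generated by the bilinear relations; but it does not kill the pair \<open>(e, 1)\<close>.
\<close>
lemma tensor_product_rational_nontrivial:
  assumes closed: "\<And>x y. x \<in> carrier G \<Longrightarrow> y \<in> carrier G \<Longrightarrow> x \<otimes>\<^bsub>G\<^esub> y \<in> carrier G"
    and add: "germ_additive F G \<psi>" and F: "F \<noteq> bot"
    and e: "e \<in> carrier G" "\<forall>\<^sub>F i in F. \<psi> i e \<noteq> 0"
  shows "carrier (tensor_product G rational_group) \<noteq> {\<one>\<^bsub>tensor_product G rational_group\<^esub>}"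
proof
  assume triv: "carrier (tensor_product G rational_group) = {\<one>\<^bsub>tensor_product G rational_group\<^esub>}"
  define P where "P = carrier G \<times> carrier rational_group"
  define A where "A = free_Abelian_group P"
  define N where "N = generate A (bilinear_relations G rational_group)"
  define f where "f i = linear_extension (\<lambda>(x, y). \<psi> i x * y)" for i
  interpret A: comm_group A
    unfolding A_def by (rule abelian_free_Abelian_group)
  define K where "K = {c \<in> carrier A. \<forall>\<^sub>F i in F. f i c = 0}"
  have "subgroup K A"
  proof (rule subgroup.intro)
    fix c d assume cd: "c \<in> K" "d \<in> K"
    then have "\<forall>\<^sub>F i in F. f i c = 0" "\<forall>\<^sub>F i in F. f i d = 0"
      by (auto simp: K_def)
    then have "\<forall>\<^sub>F i in F. f i (c \<otimes>\<^bsub>A\<^esub> d) = 0"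
      by eventually_elim (simp add: f_def A_def linear_extension_add)
    with cd show "c \<otimes>\<^bsub>A\<^esub> d \<in> K"
      by (auto simp: K_def)
  next
    fix c assume "c \<in> K"
    then have c: "\<forall>\<^sub>F i in F. f i c = 0" "c \<in> carrier A"
      by (auto simp: K_def)
    have "inv\<^bsub>A\<^esub> c = - c"
      using c(2) by (simp add: A_def)
    with c(1) have "\<forall>\<^sub>F i in F. f i (inv\<^bsub>A\<^esub> c) = 0"
      by (simp add: f_def linear_extension_minus)
    with c(2) show "inv\<^bsub>A\<^esub> c \<in> K"
      by (simp add: K_def)
  qed (auto simp: K_def f_def A_def)
  moreover have "bilinear_relations G rational_group \<subseteq> K"
  proof
    fix c assume "c \<in> bilinear_relations G rational_group"
    then consider (left) x x' y where "x \<in> carrier G" "x' \<in> carrier G"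
        "c = frag_of (x \<otimes>\<^bsub>G\<^esub> x', y) - frag_of (x, y) - frag_of (x', y)"
      | (right) x y y' where "x \<in> carrier G"
        "c = frag_of (x, y + y') - frag_of (x, y) - frag_of (x, y')"
      unfolding bilinear_relations_def rational_group_def by auto
    then show "c \<in> K"
    proof cases
      case left
      have "\<forall>\<^sub>F i in F. f i c = 0"
        using germ_additiveD[OF add left(1,2)]
        by eventually_elim (simp add: left(3) f_def linear_extension_diff distrib_right)
      moreover have "c \<in> carrier A"
        unfolding A_def left(3) carrier_free_Abelian_group_iff P_def rational_group_def
        using left(1,2) closed[OF left(1,2)] by (auto dest!: subsetD[OF keys_diff])
      ultimately show ?thesis
        by (simp add: K_def)
    next
      case right
      have "f i c = 0" for i
        by (simp add: right(2) f_def linear_extension_diff distrib_left)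
      moreover have "c \<in> carrier A"
        unfolding A_def right(2) carrier_free_Abelian_group_iff P_def rational_group_def
        using right(1) by (auto dest!: subsetD[OF keys_diff])
      ultimately show ?thesis
        by (simp add: K_def)
    qed
  qed
  ultimately have NK: "N \<subseteq> K"
    unfolding N_def by (intro A.generate_subgroup_incl)
  let ?e = "frag_of (e, 1 :: rat)"
  have eA: "?e \<in> carrier A"
    using e(1) by (simp add: A_def P_def rational_group_def)
  have tp: "tensor_product G rational_group = A Mod N"
    unfolding tensor_product_def A_def N_def P_def Let_def ..
  have "N #>\<^bsub>A\<^esub> ?e \<in> carrier (A Mod N)"
    using eA by (auto simp: FactGroup_def RCOSETS_def)
  then have "N #>\<^bsub>A\<^esub> ?e = N"
    using triv unfolding tp by (simp add: FactGroup_def)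
  moreover have "\<one>\<^bsub>A\<^esub> \<in> N"
    unfolding N_def by (rule generate.one)
  ultimately have "?e \<in> N"
    using eA A.l_one[OF eA] unfolding r_coset_def by force
  then have "\<forall>\<^sub>F i in F. f i ?e = 0"
    using NK by (auto simp: K_def)
  with e(2) have "\<forall>\<^sub>F i in F. False"
    by eventually_elim (simp add: f_def)
  with F show False
    by (simp add: eventually_False)
qed


section \<open>Evaluation of integer polynomials\<close>

definition monomial_value :: "('g \<Rightarrow> rat) \<Rightarrow> ('g \<Rightarrow>\<^sub>0 nat) \<Rightarrow> rat"
  where "monomial_value v m = (\<Prod>g \<in> Poly_Mapping.keys m. v g ^ Poly_Mapping.lookup m g)"

lemma monomial_value_superset:
  assumes "finite A" "Poly_Mapping.keys m \<subseteq> A"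
  shows "monomial_value v m = (\<Prod>g \<in> A. v g ^ Poly_Mapping.lookup m g)"
  unfolding monomial_value_def using assms
  by (intro prod.mono_neutral_left) (auto simp: in_keys_iff)

lemma monomial_value_add: "monomial_value v (m + n) = monomial_value v m * monomial_value v n"
proof -
  let ?A = "Poly_Mapping.keys m \<union> Poly_Mapping.keys n"
  have "Poly_Mapping.keys (m + n) \<subseteq> ?A"
    by (rule Poly_Mapping.keys_add)
  then show ?thesis
    by (simp add: monomial_value_superset[where A = ?A] lookup_add prod.distrib[symmetric] power_add)
qed

text \<open>
  An integer polynomial is a formal integer combination of monomials, that is, an element of the free
  abelian group on them; evaluation extends the evaluation of monomials linearly.
\<close>
definition eval_poly :: "('g \<Rightarrow> rat) \<Rightarrow> (('g \<Rightarrow>\<^sub>0 nat) \<Rightarrow>\<^sub>0 int) \<Rightarrow> rat"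
  where "eval_poly v = linear_extension (monomial_value v)"

lemma eval_poly_mult: "eval_poly v (p * q) = eval_poly v p * eval_poly v q"
proof (induction p rule: frag_induction[OF subset_UNIV])
  case (2 m)
  show ?case
    by (induction q rule: frag_induction[OF subset_UNIV])
      (simp_all add: eval_poly_def mult_single monomial_value_add linear_extension_diff right_diff_distrib)
qed (simp_all add: eval_poly_def linear_extension_diff left_diff_distrib)

lemma eval_poly_one: "eval_poly v 1 = 1"
proof -
  have "eval_poly v (frag_of 0) = 1"
    unfolding eval_poly_def linear_extension_of by (simp add: monomial_value_def)
  then show ?thesis
    by simp
qed

lemma eval_poly_var: "eval_poly v (poly_var g) = v g"
  by (simp add: eval_poly_def poly_var_def monomial_value_def)

lemma eval_poly_diff: "eval_poly v (p - q) = eval_poly v p - eval_poly v q"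
  by (simp add: eval_poly_def linear_extension_diff)

lemma eval_poly_sum: "eval_poly v (sum f T) = (\<Sum>t \<in> T. eval_poly v (f t))"
  by (simp add: eval_poly_def linear_extension_sum)

lemma cring_int_poly_ring:
  fixes G :: "'g set"
  shows "cring (int_poly_ring G)"
proof -
  let ?C = "{p :: ('g \<Rightarrow>\<^sub>0 nat) \<Rightarrow>\<^sub>0 int. \<forall>m \<in> Poly_Mapping.keys p. Poly_Mapping.keys m \<subseteq> G}"
  have mult: "p * q \<in> ?C" if "p \<in> ?C" "q \<in> ?C" for p q
  proof clarify
    fix m x assume "m \<in> Poly_Mapping.keys (p * q)" and x: "x \<in> Poly_Mapping.keys m"
    then obtain a b where "a \<in> Poly_Mapping.keys p" "b \<in> Poly_Mapping.keys q" "m = a + b"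
      using keys_mult[of p q] by auto
    then show "x \<in> G"
      using that x Poly_Mapping.keys_add[of a b] by blast
  qed
  have add: "p + q \<in> ?C" if "p \<in> ?C" "q \<in> ?C" for p q
    using that Poly_Mapping.keys_add[of p q] by blast
  have neg: "\<exists>q \<in> ?C. q + p = 0" if "p \<in> ?C" for p
    using that by (intro bexI[of _ "- p"]) auto
  have one: "1 \<in> ?C"
    by (simp flip: single_one)
  let ?R = "int_poly_ring G"
  have [simp]: "carrier ?R = ?C" "mult ?R = (*)" "one ?R = 1" "ring.zero ?R = 0" "ring.add ?R = (+)"
    by (simp_all add: int_poly_ring_def)
  have "abelian_group ?R"
  proof (rule abelian_groupI)
    fix p q assume "p \<in> carrier ?R" "q \<in> carrier ?R"
    then show "p \<oplus>\<^bsub>?R\<^esub> q \<in> carrier ?R"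
      using add[of p q] by simp
  next
    fix p assume "p \<in> carrier ?R"
    then show "\<exists>q \<in> carrier ?R. q \<oplus>\<^bsub>?R\<^esub> p = \<zero>\<^bsub>?R\<^esub>"
      using neg[of p] by simp
  qed (simp_all add: ac_simps)
  moreover have "comm_monoid ?R"
  proof (rule comm_monoidI)
    fix p q assume "p \<in> carrier ?R" "q \<in> carrier ?R"
    then show "p \<otimes>\<^bsub>?R\<^esub> q \<in> carrier ?R"
      using mult[of p q] by simp
  qed (use one in \<open>simp_all add: ac_simps\<close>)
  ultimately show ?thesis
    by (rule cringI) (simp add: distrib_right)
qed

lemma germ_ring_hom_eval_poly:
  "germ_ring_hom F (int_poly_ring G) (\<lambda>i. eval_poly (v i))"
  unfolding germ_ring_hom_def germ_additive_def int_poly_ring_def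
  by (simp add: eval_poly_mult eval_poly_one) (simp add: eval_poly_def linear_extension_add)

lemma poly_var_closed: "g \<in> G \<Longrightarrow> poly_var g \<in> carrier (int_poly_ring G)"
  by (simp add: int_poly_ring_def poly_var_def)

lemma int_poly_ring_diff_closed:
  "p \<in> carrier (int_poly_ring G) \<Longrightarrow> q \<in> carrier (int_poly_ring G) \<Longrightarrow> p - q \<in> carrier (int_poly_ring G)"
  using keys_diff[of p q] unfolding int_poly_ring_def by auto

lemma int_poly_ring_sum_closed:
  "(\<And>t. t \<in> T \<Longrightarrow> f t \<in> carrier (int_poly_ring G)) \<Longrightarrow> sum f T \<in> carrier (int_poly_ring G)"
proof (induction T rule: infinite_finite_induct)
  case (insert t T)
  then have "f t \<oplus>\<^bsub>int_poly_ring G\<^esub> sum f T \<in> carrier (int_poly_ring G)"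
    by (intro ring.ring_simprules(1)[OF cring.axioms(1)[OF cring_int_poly_ring]]) auto
  with insert.hyps show ?case
    by (simp add: int_poly_ring_def)
qed (simp_all add: int_poly_ring_def)

lemma int_poly_ring_mult_closed:
  "p \<in> carrier (int_poly_ring G) \<Longrightarrow> q \<in> carrier (int_poly_ring G) \<Longrightarrow> p * q \<in> carrier (int_poly_ring G)"
  using ring.ring_simprules(5)[OF cring.axioms(1)[OF cring_int_poly_ring], of p G q]
  by (simp add: int_poly_ring_def)


section \<open>Evaluation of the defining relations\<close>

lemma arrows_compose:
  "(Z, j, Y) \<in> arrows \<AA> \<Longrightarrow> (Y, i, X) \<in> arrows \<AA> \<Longrightarrow> (Z, compose (carrier Z) i j, X) \<in> arrows \<AA>"
  by (auto simp: arrows_def intro: embeddings_compose)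

text \<open>
  A case analysis that also provides what makes the relations polynomials in the right variables: for
  the amalgamations in \<open>T\<close>, the maps \<open>i'\<close> are arrows of \<open>\<AA>\<close>.
\<close>
lemma theta_relations_cases:
  assumes "p \<in> theta_relations \<AA>"
  obtains (iso) Y i X where "(Y, i, X) \<in> arrows \<AA>" "i \<in> isos Y X" "p = poly_var (Y, i, X) - 1"
  | (comp) Z j Y i X where "(Z, j, Y) \<in> arrows \<AA>" "(Y, i, X) \<in> arrows \<AA>"
      "p = poly_var (Z, compose (carrier Z) i j, X) - poly_var (Y, i, X) * poly_var (Z, j, Y)"
  | (amalgam) Y i X j Y' T where "(Y, i, X) \<in> arrows \<AA>" "(Y, j, Y') \<in> arrows \<AA>" "finite T"
      "amalgamation_reps \<AA> Y X Y' i j T" "\<And>X' i' j'. (X', i', j') \<in> T \<Longrightarrow> (Y', i', X') \<in> arrows \<AA>"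
      "p = poly_var (Y, i, X) - (\<Sum>(X', i', j') \<in> T. poly_var (Y', i', X'))"
proof -
  from assms consider (1) "\<exists>Y i X. p = poly_var (Y, i, X) - 1 \<and> Y \<in> \<AA> \<and> X \<in> \<AA> \<and> i \<in> isos Y X"
    | (2) "\<exists>Z j Y i X. p = poly_var (Z, compose (carrier Z) i j, X) - poly_var (Y, i, X) * poly_var (Z, j, Y) \<and>
        (Z, j, Y) \<in> arrows \<AA> \<and> (Y, i, X) \<in> arrows \<AA>"
    | (3) "\<exists>Y i X j Y' T. p = poly_var (Y, i, X) - (\<Sum>(X', i', j') \<in> T. poly_var (Y', i', X')) \<and>
        (Y, i, X) \<in> arrows \<AA> \<and> (Y, j, Y') \<in> arrows \<AA> \<and> finite T \<and> amalgamation_reps \<AA> Y X Y' i j T"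
    unfolding theta_relations_def Un_iff mem_Collect_eq by argo
  then show thesis
  proof cases
    case 1
    then show ?thesis
      using iso by (auto simp: arrows_def isos_iff_embeddings)
  next
    case 2
    then show ?thesis
      using comp by blast
  next
    case 3
    then obtain Y i X j Y' T where p: "p = poly_var (Y, i, X) - (\<Sum>(X', i', j') \<in> T. poly_var (Y', i', X'))"
      and ij: "(Y, i, X) \<in> arrows \<AA>" "(Y, j, Y') \<in> arrows \<AA>" and T: "finite T" "amalgamation_reps \<AA> Y X Y' i j T"
      by blast
    have "T \<subseteq> amalgamations \<AA> Y X Y' i j"
      using T(2) by (simp add: amalgamation_reps_def)
    then have "(Y', i', X') \<in> arrows \<AA>" if "(X', i', j') \<in> T" for X' i' j'
      using that ij(2) by (auto simp: amalgamations_def arrows_def)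
    then show ?thesis
      using amalgam[OF ij T _ p] by blast
  qed
qed

lemma theta_relations_closed: "theta_relations \<AA> \<subseteq> carrier (int_poly_ring (arrows \<AA>))"
proof
  have one: "1 \<in> carrier (int_poly_ring (arrows \<AA>))"
    using ring.ring_simprules(6)[OF cring.axioms(1)[OF cring_int_poly_ring]]
    by (simp add: int_poly_ring_def)
  fix p assume "p \<in> theta_relations \<AA>"
  then show "p \<in> carrier (int_poly_ring (arrows \<AA>))"
  proof (cases rule: theta_relations_cases)
    case iso
    then show ?thesis
      using one by (simp add: int_poly_ring_diff_closed poly_var_closed)
  next
    case comp
    then show ?thesis
      using arrows_compose[OF comp(1,2)]
      by (simp add: int_poly_ring_diff_closed int_poly_ring_mult_closed poly_var_closed)
  next
    case (amalgam Y i X j Y' T)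
    have "(\<Sum>(X', i', j') \<in> T. poly_var (Y', i', X')) \<in> carrier (int_poly_ring (arrows \<AA>))"
      using amalgam(5) by (intro int_poly_ring_sum_closed) (auto intro: poly_var_closed)
    then show ?thesis
      using amalgam(1,6) by (simp add: int_poly_ring_diff_closed poly_var_closed)
  qed
qed

lemma embedding_ratio_amalgamations:
  assumes hom: "homogeneous \<AA> \<Gamma>" and \<Gamma>: "\<Gamma> \<in> \<AA>"
    and fin: "\<And>X. X \<in> \<AA> \<Longrightarrow> finite (carrier X)"
    and sub: "\<And>S. S \<subseteq> carrier \<Gamma> \<Longrightarrow> induced \<Gamma> S \<in> \<AA>"
    and i: "(Y, i, X) \<in> arrows \<AA>" and j: "(Y, j, Y') \<in> arrows \<AA>"
    and T: "finite T" "amalgamation_reps \<AA> Y X Y' i j T"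
      "\<And>X' i' j'. (X', i', j') \<in> T \<Longrightarrow> (Y', i', X') \<in> arrows \<AA>"
    and ne: "embeddings Y' \<Gamma> \<noteq> {}"
  shows "embedding_ratio \<Gamma> (Y, i, X) = (\<Sum>(X', i', j') \<in> T. embedding_ratio \<Gamma> (Y', i', X'))"
proof -
  obtain f where f: "f \<in> embeddings Y' \<Gamma>"
    using ne by blast
  have arr: "Y \<in> \<AA>" "X \<in> \<AA>" "Y' \<in> \<AA>" "i \<in> embeddings Y X" "j \<in> embeddings Y Y'"
    using i j by (auto simp: arrows_def)
  have fj: "compose (carrier Y) f j \<in> embeddings Y \<Gamma>"
    using embeddings_compose[OF arr(5) f] .
  have T': "X' \<in> \<AA>" "i' \<in> embeddings Y' X'" if "(X', i', j') \<in> T" for X' i' j'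
    using T(3)[OF that] by (auto simp: arrows_def)
  have fin_ext: "finite (extensions \<Gamma> Y' i' X' f)" if "(X', i', j') \<in> T" for X' i' j'
    using finite_embeddings[OF fin[OF T'(1)[OF that]] fin[OF \<Gamma>]] by (simp add: extensions_def)
  have "card (extensions \<Gamma> Y i X (compose (carrier Y) f j)) =
      card (SIGMA (X', i', j') : T. extensions \<Gamma> Y' i' X' f)"
    using bij_betw_same_card[OF extensions_split_amalgamations[OF sub arr(4,5) T(2) f]] by simp
  also have "\<dots> = (\<Sum>(X', i', j') \<in> T. card (extensions \<Gamma> Y' i' X' f))"
    using T(1) fin_ext by (subst card_SigmaI) (auto intro!: sum.cong)
  finally have "embedding_ratio \<Gamma> (Y, i, X) = (\<Sum>(X', i', j') \<in> T. of_nat (card (extensions \<Gamma> Y' i' X' f)))"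
    using embedding_ratio_extensions[OF hom fin[OF \<Gamma>] fin[OF arr(2)] fin[OF arr(1)] arr(1,4) fj]
    by (simp add: case_prod_beta)
  also have "\<dots> = (\<Sum>(X', i', j') \<in> T. embedding_ratio \<Gamma> (Y', i', X'))"
    using embedding_ratio_extensions[OF hom fin[OF \<Gamma>] fin fin[OF arr(3)] arr(3) _ f] T'
    by (intro sum.cong) (auto split: prod.splits)
  finally show ?thesis .
qed

text \<open>
  The ratios \<open>\<bar>h\<^sub>\<Gamma>(X)\<bar> / \<bar>h\<^sub>\<Gamma>(Y)\<bar>\<close> are meaningful only when \<open>Y\<close> embeds into \<open>\<Gamma>\<close>.  In each case
  it suffices that one object does: the source \<open>Y\<close> of an isomorphism, the middle object \<open>Y\<close> of a
  composite, and \<open>Y'\<close> for an amalgamation.  An amalgamation that does not embed into \<open>\<Gamma>\<close>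
  contributes 0 to the sum, which is also the number of the extensions that it accounts for.
\<close>
lemma theta_relations_vanish:
  assumes fin: "\<And>X. X \<in> \<AA> \<Longrightarrow> finite (carrier X)"
    and sub: "\<And>X S. X \<in> \<AA> \<Longrightarrow> S \<subseteq> carrier X \<Longrightarrow> induced X S \<in> \<AA>"
    and p: "p \<in> theta_relations \<AA>"
  shows "\<forall>\<^sub>F \<Gamma> in homogeneous_germs \<AA>. eval_poly (embedding_ratio \<Gamma>) p = 0"
proof -
  have nz: "card (embeddings X \<Gamma>) \<noteq> 0" if "X \<in> \<AA>" "\<Gamma> \<in> \<AA>" "embeddings X \<Gamma> \<noteq> {}" for X \<Gamma>
    using finite_embeddings[OF fin[OF that(1)] fin[OF that(2)]] that(3) by simp
  from p show ?thesis
  proof (cases rule: theta_relations_cases)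
    case (iso Y i X)
    then have XY: "X \<in> \<AA>" "Y \<in> \<AA>"
      by (auto simp: arrows_def)
    show ?thesis
      using eventually_homogeneous_germs[OF XY(2)]
    proof eventually_elim
      case (elim \<Gamma>)
      then have "card (embeddings X \<Gamma>) = card (embeddings Y \<Gamma>)"
        using iso(2) XY fin by (intro card_embeddings_isos) auto
      with nz[OF XY(2), of \<Gamma>] elim show ?case
        by (simp add: iso(3) eval_poly_diff eval_poly_one eval_poly_var embedding_ratio_def)
    qed
  next
    case (comp Z j Y i X)
    then have Y: "Y \<in> \<AA>"
      by (auto simp: arrows_def)
    show ?thesis
      using eventually_homogeneous_germs[OF Y]
    proof eventually_elim
      case (elim \<Gamma>)
      with nz[OF Y, of \<Gamma>] show ?case
        by (simp add: comp(3) eval_poly_diff eval_poly_mult eval_poly_var embedding_ratio_def)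
    qed
  next
    case (amalgam Y i X j Y' T)
    then have Y': "Y' \<in> \<AA>"
      by (auto simp: arrows_def)
    show ?thesis
      using eventually_homogeneous_germs[OF Y']
    proof eventually_elim
      case (elim \<Gamma>)
      then have "embedding_ratio \<Gamma> (Y, i, X) = (\<Sum>(X', i', j') \<in> T. embedding_ratio \<Gamma> (Y', i', X'))"
        using amalgam(1-5) fin sub by (intro embedding_ratio_amalgamations) auto
      then show ?case
        by (simp add: amalgam(6) eval_poly_diff eval_poly_sum eval_poly_var case_prod_beta)
    qed
  qed
qed


section \<open>Non-vanishing\<close>

theorem theorem6p24:
  fixes \<sigma> :: "'r \<rightharpoonup> nat" and \<AA> :: "('a, 'r) rel_struct set"
  assumes "infinite (UNIV :: 'a set)"
    and "signature \<sigma>"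
    and "fraisse_class \<sigma> \<AA>"
    and "finitely_many_amalgamations \<AA>"
    and "smoothly_approximable \<AA>"
  shows "carrier (Theta_star_rat \<AA>) \<noteq> {\<one>\<^bsub>Theta_star_rat \<AA>\<^esub>}"
proof -
  have fin: "finite (carrier X)" if "X \<in> \<AA>" for X
    using assms(3) that unfolding fraisse_class_def by blast
  have sub: "induced X S \<in> \<AA>" if "X \<in> \<AA>" "S \<subseteq> carrier X" for X S
    using assms(3) that unfolding fraisse_class_def by blast
  define F where "F = homogeneous_germs \<AA>"
  define P where "P = int_poly_ring (arrows \<AA>)"
  define \<phi> where "\<phi> \<Gamma> = eval_poly (embedding_ratio \<Gamma>)" for \<Gamma> :: "('a, 'r) rel_struct"
  define \<psi> where "\<psi> \<Gamma> A = \<phi> \<Gamma> (SOME q. q \<in> A)" for \<Gamma> A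
  interpret P: cring P
    unfolding P_def by (rule cring_int_poly_ring)
  have hom: "germ_ring_hom F P \<phi>"
    unfolding P_def \<phi>_def by (rule germ_ring_hom_eval_poly)
  have rel: "theta_relations \<AA> \<subseteq> carrier P"
    unfolding P_def by (rule theta_relations_closed)
  have I: "ideal (theta_ideal \<AA>) P"
    unfolding theta_ideal_def P_def[symmetric] by (rule P.genideal_ideal[OF rel])
  have "theta_ideal \<AA> \<subseteq> {p \<in> carrier P. \<forall>\<^sub>F \<Gamma> in F. \<phi> \<Gamma> p = 0}"
    unfolding theta_ideal_def P_def[symmetric]
    by (rule P.genideal_minimal[OF germ_kernel_ideal[OF P.ring_axioms hom]])
      (use theta_relations_vanish[OF fin sub] rel in \<open>auto simp: F_def \<phi>_def\<close>)
  then have zero: "\<forall>\<^sub>F \<Gamma> in F. \<phi> \<Gamma> p = 0" if "p \<in> theta_ideal \<AA>" for p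
    using that by blast
  have Theta: "Theta \<AA> = P Quot theta_ideal \<AA>"
    by (simp add: Theta_def P_def)
  have cring: "cring (Theta \<AA>)"
    unfolding Theta by (rule ideal.quotient_is_cring[OF I P.is_cring])
  have hom': "germ_ring_hom F (Theta \<AA>) \<psi>"
    unfolding Theta \<psi>_def by (rule germ_ring_hom_Quot[OF I hom zero])
  have var: "poly_var e \<in> carrier P" if "e \<in> arrows \<AA>" for e
    unfolding P_def using that by (rule poly_var_closed)
  have classes: "theta_class \<AA> ` arrows \<AA> \<subseteq> carrier (Theta \<AA>)"
    unfolding Theta using var
    by (auto simp: theta_class_def P_def[symmetric] FactRing_def A_RCOSETS_def')
  have unit: "\<forall>\<^sub>F \<Gamma> in F. \<psi> \<Gamma> s \<noteq> 0" if s: "s \<in> theta_class \<AA> ` arrows \<AA>" for s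
  proof -
    obtain Y i X where e: "(Y, i, X) \<in> arrows \<AA>" and s: "s = theta_class \<AA> (Y, i, X)"
      using s by auto
    then have XY: "X \<in> \<AA>" "Y \<in> \<AA>"
      by (auto simp: arrows_def)
    have "\<forall>\<^sub>F \<Gamma> in F. \<psi> \<Gamma> s = \<phi> \<Gamma> (poly_var (Y, i, X))"
      unfolding s theta_class_def P_def[symmetric] \<psi>_def
      by (rule germ_ring_hom_coset[OF I hom zero var[OF e]])
    then show ?thesis
      using eventually_homogeneous_germs[OF XY(1), folded F_def]
        eventually_homogeneous_germs[OF XY(2), folded F_def]
    proof eventually_elim
      case (elim \<Gamma>)
      then have "card (embeddings X \<Gamma>) \<noteq> 0" "card (embeddings Y \<Gamma>) \<noteq> 0"
        using finite_embeddings[of X \<Gamma>] finite_embeddings[of Y \<Gamma>] fin XY by auto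
      with elim(1) show ?case
        by (simp add: \<phi>_def eval_poly_var embedding_ratio_def)
    qed
  qed
  have "F \<noteq> bot"
    unfolding F_def by (rule homogeneous_germs_not_bot[OF assms(2,3,5)])
  moreover have "\<forall>\<^sub>F \<Gamma> in F. frac_value \<psi> \<Gamma> \<one>\<^bsub>Theta_star \<AA>\<^esub> = 1"
    unfolding Theta_star_def by (rule germ_localization_one[OF cring hom' classes unit])
  then have "\<forall>\<^sub>F \<Gamma> in F. frac_value \<psi> \<Gamma> \<one>\<^bsub>Theta_star \<AA>\<^esub> \<noteq> 0"
    by eventually_elim simp
  moreover have "germ_additive F (add_monoid (Theta_star \<AA>)) (frac_value \<psi>)"
    unfolding Theta_star_def by (rule germ_localization_additive[OF cring hom' classes unit])
  moreover have "x \<oplus>\<^bsub>Theta_star \<AA>\<^esub> y \<in> carrier (Theta_star \<AA>)"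
    if "x \<in> carrier (Theta_star \<AA>)" "y \<in> carrier (Theta_star \<AA>)" for x y
    using that unfolding Theta_star_def
    by (intro germ_localization_closed[OF cring hom' classes]) (use unit in auto)
  moreover have "\<one>\<^bsub>Theta_star \<AA>\<^esub> \<in> carrier (Theta_star \<AA>)"
    unfolding Theta_star_def by (rule germ_localization_one_closed[OF cring hom' classes unit])
  ultimately show ?thesis
    unfolding Theta_star_rat_def
    by (intro tensor_product_rational_nontrivial[of _ F "frac_value \<psi>" "\<one>\<^bsub>Theta_star \<AA>\<^esub>"]) simp_all
qed

end
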